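(* Let $\kappa\ge1$ and let $M,n$ be integers with $2\log_2M\le n$. Assume the input space $\mathcal{X}$ is infinite. There exist a constant $C>0$, depending only on $\kappa$ and $c$, and a set of prediction rules $\mathcal{F}=\{f_1,\dots,f_M\}$ (functions $\mathcal{X}\to\{-1,1\}$) such that for any real-valued procedure $\bar f_n$ (a measurable function of $X$ and the sample $D_n$) there exists a probability measure $\pi$ satisfying $\mathrm{MA}(\kappa)$ for which $$\mathbb{E}[A(\bar f_n)-A^*]\ge \min_{f\in\mathcal{C}}(A(f)-A^* )+C\left(\sqrt{\frac{(\min_{f\in\mathcal{C}}A(f)-A^* )^{1/\kappa}\log M}{n}}+\left(\frac{\log M}{n}\right)^{\kappa/(2\kappa-1)}\right),$$ where $\mathcal{C}$ is the convex hull of $\mathcal{F}$, $C=c^\kappa(4e)^{-1}2^{-2\kappa(\kappa-1)/(2\kappa-1)}(\log2)^{-\kappa/(2\kappa-1)}$, and $c>0$ is the constant in the margin assumption for hinge risk $\mathrm{MAH}(\kappa)$.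
   Context: $(X,Y)$ is a random pair on $\mathcal{X}\times\{-1,1\}$ with distribution $\pi$, $D_n$ consists of $n$ i.i.d. copies. $\eta(x)=\mathbb{P}(Y=1\mid X=x)$, $f^*=\mathrm{sign}(2\eta-1)$, $R(f)=\mathbb{P}(Y\ne f(X))$, $R^*=R(f^* )$. Hinge risk $A(f)=\mathbb{E}[\max(1-Yf(X),0)]$ for real-valued $f$, $A^*=\inf_fA(f)$. $\mathrm{MA}(\kappa)$: exists $c_0>0$ with $\mathbb{E}|f(X)-f^*(X)|\le c_0(R(f)-R^* )^{1/\kappa}$ for all measurable $f:\mathcal{X}\to\{-1,1\}$. $\mathrm{MAH}(\kappa)$ with constant $c>0$: $\mathbb{E}|f(X)-f^*(X)|\le c(A(f)-A^* )^{1/\kappa}$ for all measurable $f:\mathcal{X}\to[-1,1]$. The expectation is over $D_n$ under $\pi$.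
   Formalization: Single points of 𝒳 are assumed measurable (with a trivial σ-algebra the claim fails), and c is not arbitrary: it is one suitable constant, fixed before M and n, with which the constructed π also satisfy MAH(κ). *)

theory Defs
  imports "HOL-Probability.Probability"
begin

definition XY :: "'a measure \<Rightarrow> ('a \<times> real) measure" where
  "XY MX = MX \<Otimes>\<^sub>M count_space {-1, 1}"

definition PX :: "'a measure \<Rightarrow> ('a \<times> real) measure \<Rightarrow> 'a measure" where
  "PX MX \<pi> = distr \<pi> MX fst"

text \<open>eta is (a version of) the regression function P(Y=1 | X=x).\<close>
definition regfun :: "'a measure \<Rightarrow> ('a \<times> real) measure \<Rightarrow> ('a \<Rightarrow> real) \<Rightarrow> bool" where
  "regfun MX \<pi> \<eta> \<longleftrightarrow> \<eta> \<in> borel_measurable MX \<and>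
     (\<forall>A\<in>sets MX. measure \<pi> (A \<times> {1}) = (\<integral>x\<in>A. \<eta> x \<partial>PX MX \<pi>))"

definition bayes :: "('a \<Rightarrow> real) \<Rightarrow> 'a \<Rightarrow> real" where
  "bayes \<eta> x = (if 2 * \<eta> x - 1 \<ge> 0 then 1 else -1)"

definition cls_risk :: "('a \<times> real) measure \<Rightarrow> ('a \<Rightarrow> real) \<Rightarrow> real" where
  "cls_risk \<pi> f = measure \<pi> {z \<in> space \<pi>. snd z \<noteq> f (fst z)}"

definition hinge_risk :: "('a \<times> real) measure \<Rightarrow> ('a \<Rightarrow> real) \<Rightarrow> ennreal" where
  "hinge_risk \<pi> f = (\<integral>\<^sup>+ z. ennreal (max (1 - snd z * f (fst z)) 0) \<partial>\<pi>)"

definition hinge_opt :: "'a measure \<Rightarrow> ('a \<times> real) measure \<Rightarrow> ennreal" where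
  "hinge_opt MX \<pi> = (INF f \<in> borel_measurable MX. hinge_risk \<pi> f)"

definition MA :: "'a measure \<Rightarrow> real \<Rightarrow> ('a \<times> real) measure \<Rightarrow> bool" where
  "MA MX \<kappa> \<pi> \<longleftrightarrow> (\<exists>\<eta>. regfun MX \<pi> \<eta> \<and> (\<exists>c0>0. \<forall>f \<in> borel_measurable MX.
      (\<forall>x\<in>space MX. f x \<in> {-1, 1}) \<longrightarrow>
      (\<integral>x. \<bar>f x - bayes \<eta> x\<bar> \<partial>PX MX \<pi>)
        \<le> c0 * (cls_risk \<pi> f - cls_risk \<pi> (bayes \<eta>)) powr (1 / \<kappa>)))"

definition MAH :: "'a measure \<Rightarrow> real \<Rightarrow> real \<Rightarrow> ('a \<times> real) measure \<Rightarrow> bool" where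
  "MAH MX \<kappa> c \<pi> \<longleftrightarrow> (\<exists>\<eta>. regfun MX \<pi> \<eta> \<and> (\<forall>f \<in> borel_measurable MX.
      (\<forall>x\<in>space MX. f x \<in> {-1..1}) \<longrightarrow>
      (\<integral>x. \<bar>f x - bayes \<eta> x\<bar> \<partial>PX MX \<pi>)
        \<le> c * (enn2real (hinge_risk \<pi> f - hinge_opt MX \<pi>)) powr (1 / \<kappa>)))"

definition conv_rules :: "nat \<Rightarrow> (nat \<Rightarrow> 'a \<Rightarrow> real) \<Rightarrow> ('a \<Rightarrow> real) set" where
  "conv_rules M F = {(\<lambda>x. \<Sum>i<M. \<theta> i * F i x) | \<theta>.
       (\<forall>i<M. 0 \<le> \<theta> i) \<and> (\<Sum>i<M. \<theta> i) = 1}"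

definition lb_const :: "real \<Rightarrow> real \<Rightarrow> real" where
  "lb_const \<kappa> c = c powr \<kappa> / (4 * exp 1) * 2 powr (- (2 * \<kappa> * (\<kappa> - 1) / (2 * \<kappa> - 1)))
      * ln 2 powr (- (\<kappa> / (2 * \<kappa> - 1)))"

end

theory Submission
  imports Defs
begin

text \<open>
  The mass is spread evenly, with weight \<open>w\<close> each, over \<open>N = \<lfloor>log\<^sub>2 M\<rfloor>\<close> points carrying the noisy regression
  function \<open>(1 \<plusminus> h) / 2\<close>; the rest of the mass sits on one further point without noise. The dictionary
  consists of all sign patterns on the \<open>N\<close> points, so every Bayes rule belongs to it, the oracle term \<open>m\<close>
  vanishes, and only the rate \<open>(log M / n)\<^bsup>\<kappa>/(2\<kappa>-1)\<^esup>\<close> has to be produced. By Assouad's argument the excess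
  hinge risk is at least \<open>N w h\<close> times the error of testing one sign from \<open>n\<close> observations, which is at
  least \<open>1/3\<close> as long as \<open>n w h\<^sup>2 = 1/2\<close>. The margin assumption with \<open>c\<^sup>\<kappa> = 3/2 \<cdot> 2\<^bsup>\<kappa>-1\<^esup>\<close> holds when
  \<open>v = N w\<close> satisfies \<open>v\<^bsup>\<kappa>-1\<^esup> \<le> 3/2 h\<close> and \<open>v (1 - h) \<le> 1/3\<close>; balancing these constraints gives the rate.
\<close>

subsection \<open>Margin inequality and choice of parameters\<close>

text \<open>On [v, 1] the left side is convex in \<open>z\<close> and the right side is affine, so
  the endpoints decide: at \<open>v\<close> the claim is \<open>v\<close> times the hypothesis on
  \<open>v powr (\<kappa> - 1)\<close>, at 1 the right side is at least 3/2 * (1 - 1/3) = 1. The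
  cases v = 0 and v = 1 stand apart because convexity is used on the open half-line and the
  interpolation weight divides by 1 - v.\<close>

lemma powr_le_affine:
  fixes \<kappa> v h z :: real
  assumes "1 \<le> \<kappa>" "0 \<le> v" "v \<le> 1" "h \<le> 1" "v * (1 - h) \<le> 1/3"
    and vh: "v powr (\<kappa> - 1) \<le> 3/2 * h" and z: "v \<le> z" "z \<le> 1"
  shows "z powr \<kappa> \<le> 3/2 * (z - v * (1 - h))"
proof -
  have base: "x powr \<kappa> = x * x powr (\<kappa> - 1)" if "0 \<le> x" for x :: real
    using that by (cases "x = 0") (auto simp: powr_mult_base)
  consider "v = 0" | "v = 1" | "0 < v" "v < 1" using assms by linarith
  then show ?thesis
  proof cases
    case 1
    have "z powr (\<kappa> - 1) \<le> 1"
      using powr_mono2[of "\<kappa> - 1" z 1] assms 1 by simp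
    then have "z * z powr (\<kappa> - 1) \<le> z * 1" using 1 z by (intro mult_left_mono) auto
    moreover have "z * 1 \<le> 3/2 * z" using z 1 by simp
    ultimately show ?thesis using base[of z] 1 z by simp
  next
    case 2
    then show ?thesis using assms by auto
  next
    case 3
    define \<mu> where "\<mu> = (z - v) / (1 - v)"
    have \<mu>: "0 \<le> \<mu>" "\<mu> \<le> 1" using 3 z by (auto simp: \<mu>_def)
    have "\<mu> * (1 - v) = z - v" using 3 by (simp add: \<mu>_def)
    then have zeq: "z = (1 - \<mu>) * v + \<mu> * 1" by (simp add: algebra_simps)
    have "convex_on {0<..} (\<lambda>x::real. x powr \<kappa>)" by (rule powr_convex) fact
    from convex_onD[OF this, of \<mu> v 1]
    have "z powr \<kappa> \<le> (1 - \<mu>) * v powr \<kappa> + \<mu>"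
      using \<mu> 3 zeq by simp
    moreover have "v powr \<kappa> \<le> v * (3/2 * h)"
      using base[of v] vh 3 by simp
    then have "(1 - \<mu>) * v powr \<kappa> \<le> (1 - \<mu>) * (v * (3/2 * h))"
      using \<mu> by (intro mult_left_mono) auto
    moreover have "\<mu> * 1 \<le> \<mu> * (3/2 * (1 - v * (1 - h)))"
      using \<mu> assms by (intro mult_left_mono) auto
    ultimately have "z powr \<kappa> \<le> (1 - \<mu>) * (v * (3/2 * h)) + \<mu> * (3/2 * (1 - v * (1 - h)))" by simp
    also have "\<dots> = 3/2 * (((1 - \<mu>) * v + \<mu> * 1) - v * (1 - h))"
      by (simp add: field_simps)
    also have "\<dots> = 3/2 * (z - v * (1 - h))" using zeq by simp
    finally show ?thesis .
  qed
qed

text \<open>The factor 2^(\<kappa>-1) arises because deviations from the Bayes rule reach 2 instead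
  of 1; 3/2 is the slack in the two scalar conditions on \<open>v\<close> and \<open>h\<close>. Only
  the \<kappa>-th power of this constant enters \<open>lb_const\<close>.\<close>

definition margin_const :: "real \<Rightarrow> real" where
  "margin_const \<kappa> = (3/2 * 2 powr (\<kappa> - 1)) powr (1 / \<kappa>)"

lemma margin_const_pos: "0 < margin_const \<kappa>"
  by (simp add: margin_const_def)

lemma margin_const_powr: "1 \<le> \<kappa> \<Longrightarrow> margin_const \<kappa> powr \<kappa> = 3/2 * 2 powr (\<kappa> - 1)"
  by (simp add: margin_const_def powr_powr)

text \<open>For a fixed value of \<^term>\<open>t + s\<close> the right-hand side is smallest when \<^term>\<open>t\<close> is as large as possible.\<close>

lemma margin_inequality:
  fixes \<kappa> v h s t :: real
  assumes "1 \<le> \<kappa>" "0 \<le> v" "v \<le> 1" "0 \<le> h" "h \<le> 1" "v * (1 - h) \<le> 1/3"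
    and vh: "v powr (\<kappa> - 1) \<le> 3/2 * h"
    and t: "0 \<le> t" "t \<le> 2 * v" and s: "0 \<le> s" "s \<le> 2 * (1 - v)"
  shows "t + s \<le> margin_const \<kappa> * (h * t + s) powr (1 / \<kappa>)"
proof -
  have "(t + s) powr \<kappa> \<le> 3/2 * 2 powr (\<kappa> - 1) * (h * t + s)"
  \<comment> \<open>Here \<open>t\<close> is the deviation integrated over the noisy points and
    \<open>s\<close> that at the noiseless point. For a total of at most 2v, one factor t + s is
    kept and the remaining power is bounded by its value at 2v. Otherwise \<open>t\<close> is
    replaced by its maximum 2v, and half the total lies in [v, 1], where
    \<open>powr_le_affine\<close> applies.\<close>
  proof (cases "t + s \<le> 2 * v")
    case True
    show ?thesis
    proof (cases "t + s = 0")
      case True then show ?thesis using t s by (simp add: add_nonneg_eq_0_iff)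
    next
      case False
      then have pos: "0 < t + s" using t s by linarith
      then have "(t + s) powr \<kappa> = (t + s) * (t + s) powr (\<kappa> - 1)"
        by (simp add: powr_mult_base)
      also have "\<dots> \<le> (t + s) * (2 * v) powr (\<kappa> - 1)"
        using True pos assms(1) by (intro mult_left_mono powr_mono2) auto
      also have "(2 * v) powr (\<kappa> - 1) = 2 powr (\<kappa> - 1) * v powr (\<kappa> - 1)"
        by (rule powr_mult)
      also have "(t + s) * \<dots> \<le> (t + s) * (2 powr (\<kappa> - 1) * (3/2 * h))"
        using vh pos by (intro mult_left_mono) auto
      also have "\<dots> = 3/2 * 2 powr (\<kappa> - 1) * (h * t + h * s)" by (simp add: algebra_simps)
      also have "\<dots> \<le> 3/2 * 2 powr (\<kappa> - 1) * (h * t + s)"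
        using mult_right_mono[of h 1 s] s assms by (intro mult_left_mono add_left_mono) auto
      finally show ?thesis .
    qed
  next
    case False
    define z where "z = (t + s) / 2"
    have z: "v \<le> z" "z \<le> 1" using False t s by (auto simp: z_def)
    have "(t + s) powr \<kappa> = (2 * z) powr \<kappa>" by (simp add: z_def del: distrib_left_numeral)
    also have "\<dots> = 2 powr \<kappa> * z powr \<kappa>" by (rule powr_mult)
    also have "\<dots> \<le> 2 powr \<kappa> * (3/2 * (z - v * (1 - h)))"
      using powr_le_affine[OF _ _ _ _ _ vh z] assms by (intro mult_left_mono) auto
    also have "2 powr \<kappa> = 2 * 2 powr (\<kappa> - 1)" by (simp add: powr_mult_base)
    also have "2 * 2 powr (\<kappa> - 1) * (3/2 * (z - v * (1 - h)))
      = 3/2 * 2 powr (\<kappa> - 1) * (t + s - 2 * v * (1 - h))"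
      by (simp add: z_def field_simps)
    also have "\<dots> \<le> 3/2 * 2 powr (\<kappa> - 1) * (h * t + s)"
    proof (intro mult_left_mono)
      have "t * (1 - h) \<le> 2 * v * (1 - h)" using t assms by (intro mult_right_mono) auto
      then show "t + s - 2 * v * (1 - h) \<le> h * t + s" by (simp add: algebra_simps)
    qed auto
    finally show ?thesis .
  qed
  then have "((t + s) powr \<kappa>) powr (1 / \<kappa>) \<le> (3/2 * 2 powr (\<kappa> - 1) * (h * t + s)) powr (1 / \<kappa>)"
    using assms by (intro powr_mono2) auto
  also have "\<dots> = margin_const \<kappa> * (h * t + s) powr (1 / \<kappa>)"
    unfolding margin_const_def by (rule powr_mult)
  finally show ?thesis using assms by (simp add: powr_powr)
qed

section \<open>Balancing the noisy mass against the noise level\<close>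

text \<open>With u = N/n, \<open>h\<close> solves n w h^2 = 1/2 for w = v/N. Equating v^(\<kappa>-1)
  with \<open>h\<close> up to constants gives v of order u^(1/(2\<kappa>-1)), and 1/(2\<kappa>-1) is
  1 - 2\<theta>. The power of 1/3 makes \<open>v\<close> a weighted geometric mean of 1/3 and
  \<open>u\<close>, hence a number between them. The product h v then has the exponent 1 - \<theta>
  = \<kappa>/(2\<kappa>-1) of the rate.\<close>

lemma rate_parameters:
  fixes \<kappa> u v h \<theta> :: real
  assumes "1 \<le> \<kappa>" "0 < u" "u \<le> 1/2"
    and \<theta>_def: "\<theta> = (\<kappa> - 1) / (2 * \<kappa> - 1)"
    and v_def: "v = (1/3) powr (2 * \<theta>) * u powr (1 - 2 * \<theta>)"
    and h_def: "h = sqrt (u / (2 * v))"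
  shows "0 < v" "v \<le> 1" "0 < h" "h \<le> 1" "v * (1 - h) \<le> 1/3" "v powr (\<kappa> - 1) \<le> 3/2 * h"
    "v * h\<^sup>2 = u / 2" "h * v = (1/3) powr \<theta> * u powr (1 - \<theta>) / sqrt 2"
proof -
  have th: "0 \<le> \<theta>" "2 * \<theta> \<le> 1" using assms(1) by (auto simp: \<theta>_def field_simps)
  show v: "0 < v" using assms(2) by (simp add: v_def)
  show h0: "0 < h" using v assms(2) by (simp add: h_def)
  have sum1: "x powr (2 * \<theta>) * x powr (1 - 2 * \<theta>) = x" if "0 < x" for x :: real
    using that by (simp flip: powr_add)
  have *: "v \<le> max (1/3) u" "min (1/3) u \<le> v"
  proof -
    have "v \<le> max (1/3) u powr (2 * \<theta>) * max (1/3) u powr (1 - 2 * \<theta>)"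
      unfolding v_def using th assms by (intro mult_mono powr_mono2) auto
    then show "v \<le> max (1/3) u" using sum1[of "max (1/3) u"] assms by simp
    have "min (1/3) u powr (2 * \<theta>) * min (1/3) u powr (1 - 2 * \<theta>) \<le> v"
      unfolding v_def using th assms by (intro mult_mono powr_mono2) auto
    then show "min (1/3) u \<le> v" using sum1[of "min (1/3) u"] assms by simp
  qed
  show "v \<le> 1" using * assms by simp
  have uv: "u \<le> 2 * v" using * assms by (simp add: min_def split: if_splits)
  show h1: "h \<le> 1" unfolding h_def using uv v by simp
  \<comment> \<open>For u > 1/3 the bound v \<le> 1/3 may fail, but then v \<le> u \<le> 1/2 gives h
    \<ge> 1/2 and the product is at most 1/4.\<close>
  show "v * (1 - h) \<le> 1/3"
  proof (cases "u \<le> 1/3")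
    case True
    then have "v \<le> 1/3" using * by simp
    then show ?thesis using mult_left_mono[of "1 - h" 1 v] v h0 by linarith
  next
    case False
    then have vu: "v \<le> u" using * by simp
    have "sqrt (1/4) \<le> h" unfolding h_def using vu v by (intro real_sqrt_le_mono) (simp add: field_simps)
    then have "1/2 \<le> h" by (simp add: real_sqrt_divide)
    then have "v * (1 - h) \<le> (1/2) * (1/2)" using h1 vu assms v by (intro mult_mono) auto
    then show ?thesis by simp
  qed
  have h2: "h\<^sup>2 = u / (2 * v)" unfolding h_def using v \<open>0 < u\<close> by simp
  then show "v * h\<^sup>2 = u / 2" using v by simp
  have hv2: "(h * v)\<^sup>2 = u * v / 2" using h2 v
    by (simp add: power_mult_distrib) (simp add: power2_eq_square)
  have e1: "2 * \<theta> * (1 / 2) = \<theta>" "(1 - 2 * \<theta>) * (1/2) = 1/2 - \<theta>" by (auto simp: algebra_simps)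
  have sv: "sqrt v = (1/3) powr \<theta> * u powr (1/2 - \<theta>)"
  proof -
    have "sqrt v = v powr (1/2)" using v by (simp add: powr_half_sqrt)
    also have "\<dots> = ((1/3) powr (2 * \<theta>)) powr (1/2) * (u powr (1 - 2 * \<theta>)) powr (1/2)"
      unfolding v_def by (rule powr_mult)
    finally show ?thesis unfolding powr_powr e1 .
  qed
  have "h * v = sqrt (u * v / 2)" using hv2 h0 v by (metis less_eq_real_def real_sqrt_unique mult_pos_pos)
  also have "\<dots> = sqrt u * sqrt v / sqrt 2" by (simp add: real_sqrt_divide real_sqrt_mult)
  also have "sqrt u * sqrt v = (1/3) powr \<theta> * (u powr (1/2) * u powr (1/2 - \<theta>))"
    using \<open>0 < u\<close> by (simp add: sv powr_half_sqrt)
  also have "u powr (1/2) * u powr (1/2 - \<theta>) = u powr (1 - \<theta>)"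
    by (simp flip: powr_add)
  finally show hv: "h * v = (1/3) powr \<theta> * u powr (1 - \<theta>) / sqrt 2" .
  show "v powr (\<kappa> - 1) \<le> 3/2 * h"
  proof -
    have ex: "2 * \<theta> * (\<kappa> - 1/2) = \<kappa> - 1" "(1 - 2 * \<theta>) * (\<kappa> - 1/2) = 1/2"
      using assms(1) by (auto simp: \<theta>_def field_simps)
    \<comment> \<open>After multiplication by \<open>sqrt v\<close> both sides are explicit: the
      left is (1/3)^(\<kappa>-1) * sqrt u, the right is 3/2 * sqrt (u/2), and 3/2 exceeds sqrt
      2.\<close>
    have "v powr (\<kappa> - 1) * sqrt v = v powr (\<kappa> - 1/2)"
      using v by (simp flip: powr_half_sqrt powr_add)
    also have "\<dots> = ((1/3) powr (2 * \<theta>)) powr (\<kappa> - 1/2) * (u powr (1 - 2 * \<theta>)) powr (\<kappa> - 1/2)"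
      unfolding v_def by (rule powr_mult)
    also have "\<dots> = (1/3) powr (\<kappa> - 1) * sqrt u"
      unfolding powr_powr ex using \<open>0 < u\<close> by (simp add: powr_half_sqrt)
    also have "\<dots> \<le> 1 * sqrt u"
      using powr_mono2[of "\<kappa> - 1" "1/3" 1] assms(1,2) by (intro mult_right_mono) auto
    also have "\<dots> \<le> (3/2 * h) * sqrt v"
    proof -
      have "3/2 * h * sqrt v = 3/2 * (sqrt u / sqrt 2)"
        unfolding h_def using v by (simp add: real_sqrt_divide real_sqrt_mult)
      moreover have "sqrt 2 \<le> 3/2" by (rule real_le_lsqrt) (auto simp: power2_eq_square)
      then have "sqrt u * sqrt 2 \<le> sqrt u * (3/2)" using assms by (intro mult_left_mono) auto
      then have "1 * sqrt u \<le> sqrt u * (3/2) / sqrt 2" by (simp add: pos_le_divide_eq)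
      ultimately show ?thesis by simp
    qed
    finally show ?thesis using v by simp
  qed
qed

text \<open>With L = log2 M / n, the powers of ln 2 cancel, and the powers of 2 from
  \<open>margin_const\<close> and \<open>lb_const\<close> combine to 2^(-\<theta>). What remains is
  a numerical comparison; 3/5 is the loss from rounding log2 M down to an integer.\<close>

lemma lb_const_le:
  fixes \<kappa> L u \<theta> :: real
  assumes "1 \<le> \<kappa>" "0 < L" and u: "3/5 * L \<le> u"
    and \<theta>_def: "\<theta> = (\<kappa> - 1) / (2 * \<kappa> - 1)"
  shows "lb_const \<kappa> (margin_const \<kappa>) * (ln 2 * L) powr (\<kappa> / (2 * \<kappa> - 1))
    \<le> (1/3) powr \<theta> * u powr (1 - \<theta>) / sqrt 2 / 3"
proof -
  have th: "0 \<le> \<theta>" "2 * \<theta> \<le> 1" using assms(1) by (auto simp: \<theta>_def field_simps)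
  have k1: "\<kappa> / (2 * \<kappa> - 1) = 1 - \<theta>" using assms(1) by (simp add: \<theta>_def field_simps)
  have k2: "\<kappa> - 1 + - (2 * \<kappa> * (\<kappa> - 1) / (2 * \<kappa> - 1)) = - \<theta>"
    using assms(1) unfolding \<theta>_def by (simp add: field_simps)
  have l2: "0 < ln (2::real)" by simp
  have "lb_const \<kappa> (margin_const \<kappa>) * (ln 2 * L) powr (\<kappa> / (2 * \<kappa> - 1))
    = 3/2 / (4 * exp 1) * (2 powr (\<kappa> - 1) * 2 powr (- (2 * \<kappa> * (\<kappa> - 1) / (2 * \<kappa> - 1))))
      * (ln 2 powr (- (1 - \<theta>)) * (ln 2 * L) powr (1 - \<theta>))"
    unfolding lb_const_def margin_const_powr[OF assms(1)] k1 by simp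
  also have "2 powr (\<kappa> - 1) * 2 powr (- (2 * \<kappa> * (\<kappa> - 1) / (2 * \<kappa> - 1))) = 2 powr (- \<theta>)"
    unfolding powr_add[symmetric] k2 ..
  also have "(ln 2 * L) powr (1 - \<theta>) = ln 2 powr (1 - \<theta>) * L powr (1 - \<theta>)"
    using assms l2 by (simp add: powr_mult)
  also have "ln 2 powr (- (1 - \<theta>)) * (ln 2 powr (1 - \<theta>) * L powr (1 - \<theta>)) = L powr (1 - \<theta>)"
    using l2 by (simp add: mult.assoc[symmetric] flip: powr_add)
  finally have lhs: "lb_const \<kappa> (margin_const \<kappa>) * (ln 2 * L) powr (\<kappa> / (2 * \<kappa> - 1))
    = 3/2 / (4 * exp 1) * 2 powr (- \<theta>) * L powr (1 - \<theta>)" .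
  have num: "3/2 / (4 * exp 1) * 3 * sqrt 2 \<le> 3/5"
  proof -
    have "(8/3::real) \<le> exp 1"
      using exp_lower_Taylor_quadratic[of "1::real"] e_approx_32 by (simp add: field_simps abs_if split: if_splits)
    moreover have "sqrt 2 \<le> 142/100" by (rule real_le_lsqrt) (auto simp: power2_eq_square)
    ultimately show ?thesis by (simp add: field_simps)
  qed
  \<comment> \<open>Splitting 3/5 with exponents \<theta> and 1 - \<theta> and enlarging the first
    base to 2/3 produces 2^\<theta> * (1/3)^\<theta>, whose first factor cancels the 2^(-\<theta>)
    above.\<close>
  have "3/5 = (3/5) powr \<theta> * (3/5) powr (1 - \<theta>)" by (simp flip: powr_add)
  also have "\<dots> \<le> (2/3) powr \<theta> * (3/5) powr (1 - \<theta>)"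
    using th by (intro mult_right_mono powr_mono2) auto
  also have "(2/3) powr \<theta> = 2 powr \<theta> * (1/3) powr \<theta>" by (simp flip: powr_mult)
  finally have "3/2 / (4 * exp 1) * 3 * sqrt 2 \<le> 2 powr \<theta> * (1/3) powr \<theta> * (3/5) powr (1 - \<theta>)"
    using num by linarith
  then have "3/2 / (4 * exp 1) * 3 * sqrt 2 * (2 powr (- \<theta>) * L powr (1 - \<theta>))
    \<le> 2 powr \<theta> * (1/3) powr \<theta> * (3/5) powr (1 - \<theta>) * (2 powr (- \<theta>) * L powr (1 - \<theta>))"
    by (intro mult_right_mono) auto
  also have "\<dots> = (1/3) powr \<theta> * ((3/5) powr (1 - \<theta>) * L powr (1 - \<theta>))"
    by (simp add: powr_minus)
  also have "(3/5) powr (1 - \<theta>) * L powr (1 - \<theta>) = (3/5 * L) powr (1 - \<theta>)"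
    by (rule powr_mult[symmetric])
  also have "(1/3) powr \<theta> * \<dots> \<le> (1/3) powr \<theta> * u powr (1 - \<theta>)"
    using th assms by (intro mult_left_mono powr_mono2) auto
  finally show ?thesis unfolding lhs by (simp add: field_simps)
qed

subsection \<open>Distributions with a prescribed regression function\<close>

text \<open>The law with marginal \<open>Q\<close> and P(Y = y | X = x) = (1 + y g(x)) / 2, so
  \<open>g\<close> is 2\<eta> - 1: its sign is the Bayes rule and its absolute value measures the
  absence of noise.\<close>

definition noise_dist :: "'a measure \<Rightarrow> ('a \<Rightarrow> real) \<Rightarrow> ('a \<times> real) measure" where
  "noise_dist Q g = density (Q \<Otimes>\<^sub>M count_space {-1, 1}) (\<lambda>(x, y). ennreal ((1 + y * g x) / 2))"

lemma sets_noise_dist: "sets Q = sets MX \<Longrightarrow> sets (noise_dist Q g) = sets (XY MX)"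
  unfolding noise_dist_def XY_def sets_density by (intro sets_pair_measure_cong) simp_all

section \<open>Conditional hinge risk\<close>

definition sgn1 :: "real \<Rightarrow> real" where "sgn1 a = (if 0 \<le> a then 1 else -1)"

text \<open>The expected hinge loss of the prediction \<open>y\<close> at a point where 2\<eta> - 1
  equals \<open>a\<close>.\<close>

definition hinge_cond :: "real \<Rightarrow> real \<Rightarrow> real" where
  "hinge_cond a y = (1 + a) / 2 * max (1 - y) 0 + (1 - a) / 2 * max (1 + y) 0"

definition clip :: "real \<Rightarrow> real" where "clip y = max (- 1) (min 1 y)"

text \<open>On [-1, 1] both hinge terms are affine and the conditional risk has slope -a, with
  minimum 1 - |a| at \<open>sgn1 a\<close>. Outside, one term vanishes and the other exceeds 2, so
  clipping never increases the risk. This reduces arbitrary real-valued procedures to bounded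
  ones.\<close>

lemma hinge_cond_ge: "\<bar>a\<bar> \<le> 1 \<Longrightarrow> 1 - \<bar>a\<bar> + \<bar>a\<bar> * \<bar>clip y - sgn1 a\<bar> \<le> hinge_cond a y"
proof -
  assume a: "\<bar>a\<bar> \<le> 1"
  consider "y < -1" | "1 < y" | "-1 \<le> y" "y \<le> 1" by linarith
  then show ?thesis
  proof cases
    case 1
    then have "(1 + a) / 2 * 2 \<le> (1 + a) / 2 * (1 - y)" using a by (intro mult_left_mono) auto
    with 1 a show ?thesis by (auto simp: hinge_cond_def clip_def sgn1_def abs_if max_def min_def field_simps split: if_splits)
  next
    case 2
    then have "(1 - a) / 2 * 2 \<le> (1 - a) / 2 * (1 + y)" using a by (intro mult_left_mono) auto
    with 2 a show ?thesis by (auto simp: hinge_cond_def clip_def sgn1_def abs_if max_def min_def field_simps split: if_splits)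
  next
    case 3
    then have "max (1 - y) 0 = 1 - y" "max (1 + y) 0 = 1 + y" by auto
    with 3 show ?thesis by (auto simp: hinge_cond_def clip_def sgn1_def abs_if max_def min_def field_simps split: if_splits)
  qed
qed

lemma hinge_cond_eq: "\<bar>y\<bar> \<le> 1 \<Longrightarrow> hinge_cond a y = 1 - \<bar>a\<bar> + \<bar>a\<bar> * \<bar>y - sgn1 a\<bar>"
proof -
  assume "\<bar>y\<bar> \<le> 1"
  then have "max (1 - y) 0 = 1 - y" "max (1 + y) 0 = 1 + y" and y: "-1 \<le> y" "y \<le> 1" by auto
  with y show ?thesis by (auto simp: hinge_cond_def sgn1_def abs_if field_simps)
qed

lemma sgn1_cases: "sgn1 a \<in> {-1, 1}" by (simp add: sgn1_def)

lemma measurable_sgn1 [measurable]: "sgn1 \<in> borel_measurable borel"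
  unfolding sgn1_def[abs_def] by measurable

lemma measurable_clip [measurable]: "clip \<in> borel_measurable borel"
  unfolding clip_def[abs_def] by measurable

lemma measurable_hinge_cond [measurable]:
  assumes [measurable]: "g \<in> borel_measurable M" "f \<in> borel_measurable M"
  shows "(\<lambda>x. hinge_cond (g x) (f x)) \<in> borel_measurable M"
  unfolding hinge_cond_def by measurable

section \<open>Risks and margin conditions for a given marginal and regression function\<close>

locale noise = prob_space Q for Q :: "'a measure" +
  fixes MX :: "'a measure" and g :: "'a \<Rightarrow> real"
  assumes sets_Q [measurable_cong]: "sets Q = sets MX"
    and g_meas [measurable]: "g \<in> borel_measurable MX"
    and g_bound: "\<And>x. \<bar>g x\<bar> \<le> 1"
begin

lemma space_Q: "space Q = space MX"
  using sets_Q by (rule sets_eq_imp_space_eq)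

abbreviation "\<pi> \<equiv> noise_dist Q g"

lemma sets_pi [measurable_cong]: "sets \<pi> = sets (XY MX)"
  using sets_Q by (rule sets_noise_dist)

lemma snd_measurable: "snd \<in> borel_measurable (XY MX)"
  unfolding XY_def by (rule measurable_compose[OF measurable_snd]) simp

lemma density_measurable:
  "(\<lambda>(x, y). ennreal ((1 + y * g x) / 2)) \<in> borel_measurable (Q \<Otimes>\<^sub>M count_space {-1, 1})"
proof -
  have [measurable]: "snd \<in> borel_measurable (Q \<Otimes>\<^sub>M count_space {-1, 1})"
    by (rule measurable_compose[OF measurable_snd]) simp
  show ?thesis unfolding case_prod_beta by measurable
qed

lemma nn_integral_noise:
  assumes F: "F \<in> borel_measurable (XY MX)"
  shows "(\<integral>\<^sup>+ z. F z \<partial>\<pi>)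
    = (\<integral>\<^sup>+ x. ennreal ((1 + g x) / 2) * F (x, 1) + ennreal ((1 - g x) / 2) * F (x, -1) \<partial>Q)"
proof -
  interpret C: sigma_finite_measure "count_space {-1, 1 :: real}"
    by (rule sigma_finite_measure_count_space_finite) simp
  have F' [measurable]: "F \<in> borel_measurable (Q \<Otimes>\<^sub>M count_space {-1, 1})"
    using F sets_Q by (simp add: XY_def cong: measurable_cong_sets sets_pair_measure_cong)
  note density_measurable [measurable]
  have "(\<integral>\<^sup>+ z. F z \<partial>\<pi>) = (\<integral>\<^sup>+ z. (case z of (x, y) \<Rightarrow> ennreal ((1 + y * g x) / 2)) * F z \<partial>(Q \<Otimes>\<^sub>M count_space {-1, 1}))"
    unfolding noise_dist_def by (rule nn_integral_density) measurable
  also have "\<dots> = (\<integral>\<^sup>+ x. \<integral>\<^sup>+ y. ennreal ((1 + y * g x) / 2) * F (x, y) \<partial>count_space {-1, 1} \<partial>Q)"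
    by (subst C.nn_integral_fst[symmetric]) simp_all
  also have "\<dots> = (\<integral>\<^sup>+ x. ennreal ((1 + g x) / 2) * F (x, 1) + ennreal ((1 - g x) / 2) * F (x, -1) \<partial>Q)"
    by (simp add: nn_integral_count_space_finite add.commute)
  finally show ?thesis .
qed

lemma weight_nonneg: "0 \<le> (1 + g x) / 2" "0 \<le> (1 - g x) / 2"
  using g_bound[of x] by (auto simp: abs_le_iff)

lemma weight_sum: "ennreal ((1 + g x) / 2) + ennreal ((1 - g x) / 2) = 1"
  using g_bound[of x] by (subst ennreal_plus[symmetric]) (auto simp: abs_le_iff field_simps)

lemma prob_space_pi: "prob_space \<pi>"
proof (rule prob_spaceI)
  have "emeasure \<pi> (space \<pi>) = (\<integral>\<^sup>+ z. 1 \<partial>\<pi>)" by simp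
  also have "\<dots> = (\<integral>\<^sup>+ x. 1 \<partial>Q)"
    by (subst nn_integral_noise) (simp_all add: weight_sum)
  also have "\<dots> = 1" by (simp add: emeasure_space_1)
  finally show "emeasure \<pi> (space \<pi>) = 1" .
qed

lemma fst_measurable: "fst \<in> measurable (XY MX) MX"
  unfolding XY_def by simp

lemma PX_pi: "PX MX \<pi> = Q"
proof (rule measure_eqI)
  show "sets (PX MX \<pi>) = sets Q" by (simp add: PX_def sets_Q)
  fix A assume "A \<in> sets (PX MX \<pi>)"
  then have A [measurable]: "A \<in> sets MX" by (simp add: PX_def)
  note fst_measurable [measurable]
  have "emeasure (PX MX \<pi>) A = (\<integral>\<^sup>+ x. indicator A x \<partial>PX MX \<pi>)"
    by (rule nn_integral_indicator[symmetric]) (simp add: PX_def)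
  also have "\<dots> = (\<integral>\<^sup>+ z. indicator A (fst z) \<partial>\<pi>)"
    unfolding PX_def by (rule nn_integral_distr) measurable
  also have "\<dots> = (\<integral>\<^sup>+ x. indicator A x \<partial>Q)"
    by (subst nn_integral_noise) (simp_all add: weight_sum flip: distrib_right)
  also have "\<dots> = emeasure Q A" by (rule nn_integral_indicator) measurable
  finally show "emeasure (PX MX \<pi>) A = emeasure Q A" .
qed

lemma regfun_pi: "regfun MX \<pi> (\<lambda>x. (1 + g x) / 2)"
  unfolding regfun_def PX_pi
proof (intro conjI ballI)
  show "(\<lambda>x. (1 + g x) / 2) \<in> borel_measurable MX" by measurable
  fix A assume A [measurable]: "A \<in> sets MX"
  have AX: "A \<times> {1} \<in> sets (XY MX)" unfolding XY_def by (rule pair_measureI) auto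
  have "emeasure \<pi> (A \<times> {1}) = (\<integral>\<^sup>+ z. indicator (A \<times> {1}) z \<partial>\<pi>)"
    using AX sets_pi by simp
  also have "\<dots> = (\<integral>\<^sup>+ x. ennreal (indicator A x * ((1 + g x) / 2)) \<partial>Q)"
    using AX by (subst nn_integral_noise)
      (auto intro!: nn_integral_cong split: split_indicator)
  finally have e: "emeasure \<pi> (A \<times> {1}) = \<dots>" .
  have "(\<integral>x\<in>A. (1 + g x) / 2 \<partial>Q) = enn2real (\<integral>\<^sup>+ x. ennreal (indicator A x * ((1 + g x) / 2)) \<partial>Q)"
    unfolding set_lebesgue_integral_def using weight_nonneg
    by (subst integral_eq_nn_integral) (auto simp: indicator_def)
  then show "measure \<pi> (A \<times> {1}) = (\<integral>x\<in>A. (1 + g x) / 2 \<partial>Q)"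
    by (simp add: measure_def e)
qed

lemma bayes_eq: "bayes (\<lambda>x. (1 + g x) / 2) = (\<lambda>x. sgn1 (g x))"
  by (auto simp: bayes_def sgn1_def fun_eq_iff)

lemma hinge_risk_eq:
  assumes f [measurable]: "f \<in> borel_measurable MX"
  shows "hinge_risk \<pi> f = (\<integral>\<^sup>+ x. ennreal (hinge_cond (g x) (f x)) \<partial>Q)"
proof -
  note fst_measurable [measurable] snd_measurable [measurable]
  have "hinge_risk \<pi> f = (\<integral>\<^sup>+ x. ennreal ((1 + g x) / 2) * ennreal (max (1 - f x) 0)
      + ennreal ((1 - g x) / 2) * ennreal (max (1 + f x) 0) \<partial>Q)"
    unfolding hinge_risk_def by (subst nn_integral_noise) simp_all
  also have "\<dots> = (\<integral>\<^sup>+ x. ennreal (hinge_cond (g x) (f x)) \<partial>Q)"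
  proof (rule nn_integral_cong)
    fix x
    show "ennreal ((1 + g x) / 2) * ennreal (max (1 - f x) 0)
      + ennreal ((1 - g x) / 2) * ennreal (max (1 + f x) 0) = ennreal (hinge_cond (g x) (f x))"
      unfolding hinge_cond_def using weight_nonneg[of x]
      by (subst ennreal_plus) (auto simp: ennreal_mult simp del: ennreal_max_0 times_divide_eq_left)
  qed
  finally show ?thesis .
qed

text \<open>Integrates the pointwise bound for the conditional risk. The first summand turns out to
  be the optimal hinge risk, so the second is a lower bound for the excess.\<close>

lemma hinge_risk_ge:
  assumes f [measurable]: "f \<in> borel_measurable MX"
  shows "(\<integral>\<^sup>+ x. ennreal (1 - \<bar>g x\<bar>) \<partial>Q) + (\<integral>\<^sup>+ x. ennreal (\<bar>g x\<bar> * \<bar>clip (f x) - sgn1 (g x)\<bar>) \<partial>Q) \<le> hinge_risk \<pi> f"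
proof -
  have "(\<integral>\<^sup>+ x. ennreal (1 - \<bar>g x\<bar>) \<partial>Q) + (\<integral>\<^sup>+ x. ennreal (\<bar>g x\<bar> * \<bar>clip (f x) - sgn1 (g x)\<bar>) \<partial>Q)
    = (\<integral>\<^sup>+ x. ennreal (1 - \<bar>g x\<bar>) + ennreal (\<bar>g x\<bar> * \<bar>clip (f x) - sgn1 (g x)\<bar>) \<partial>Q)"
    by (rule nn_integral_add[symmetric]) measurable
  also have "\<dots> \<le> (\<integral>\<^sup>+ x. ennreal (hinge_cond (g x) (f x)) \<partial>Q)"
    using g_bound hinge_cond_ge
    by (intro nn_integral_mono) (simp flip: ennreal_plus add: ennreal_leI)
  finally show ?thesis using hinge_risk_eq[OF f] by simp
qed

lemma hinge_risk_bounded: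
  assumes f [measurable]: "f \<in> borel_measurable MX" and b: "\<And>x. x \<in> space MX \<Longrightarrow> \<bar>f x\<bar> \<le> 1"
  shows "hinge_risk \<pi> f = (\<integral>\<^sup>+ x. ennreal (1 - \<bar>g x\<bar>) \<partial>Q) + (\<integral>\<^sup>+ x. ennreal (\<bar>g x\<bar> * \<bar>f x - sgn1 (g x)\<bar>) \<partial>Q)"
  unfolding hinge_risk_eq[OF f] using g_bound b
  by (subst nn_integral_add[symmetric])
     (auto intro!: nn_integral_cong simp: hinge_cond_eq space_Q simp flip: ennreal_plus)

text \<open>The Bayes rule makes the deviation term vanish and so attains the lower bound of
  \<open>hinge_risk_ge\<close>.\<close>

lemma hinge_opt_eq: "hinge_opt MX \<pi> = (\<integral>\<^sup>+ x. ennreal (1 - \<bar>g x\<bar>) \<partial>Q)"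
  unfolding hinge_opt_def
proof (rule antisym)
  have "(INF f\<in>borel_measurable MX. hinge_risk \<pi> f) \<le> hinge_risk \<pi> (\<lambda>x. sgn1 (g x))"
    by (rule INF_lower) measurable
  also have "\<dots> = (\<integral>\<^sup>+ x. ennreal (1 - \<bar>g x\<bar>) \<partial>Q)"
    by (subst hinge_risk_bounded) (auto simp: sgn1_def)
  finally show "(INF f\<in>borel_measurable MX. hinge_risk \<pi> f) \<le> \<dots>" .
  show "(\<integral>\<^sup>+ x. ennreal (1 - \<bar>g x\<bar>) \<partial>Q) \<le> (INF f\<in>borel_measurable MX. hinge_risk \<pi> f)"
    by (intro INF_greatest order_trans[OF _ hinge_risk_ge]) auto
qed

text \<open>Finiteness is what lets the optimal risk cancel in \<open>ennreal\<close>
  subtraction.\<close>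

lemma hinge_opt_finite: "hinge_opt MX \<pi> < top"
proof -
  have "hinge_opt MX \<pi> \<le> (\<integral>\<^sup>+ x. 1 \<partial>Q)"
    unfolding hinge_opt_eq by (intro nn_integral_mono) (simp add: ennreal_le_1)
  also have "\<dots> = 1" by (simp add: emeasure_space_1)
  finally show ?thesis by (auto simp: less_top[symmetric] top_unique)
qed

lemma excess_hinge_ge:
  assumes "f \<in> borel_measurable MX"
  shows "(\<integral>\<^sup>+ x. ennreal (\<bar>g x\<bar> * \<bar>clip (f x) - sgn1 (g x)\<bar>) \<partial>Q) \<le> hinge_risk \<pi> f - hinge_opt MX \<pi>"
  using hinge_risk_ge[OF assms] unfolding hinge_opt_eq[symmetric] 
  by (subst ennreal_le_minus_iff) (simp add: add.commute)

lemma excess_hinge_bounded: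
  assumes f [measurable]: "f \<in> borel_measurable MX" and b: "\<And>x. x \<in> space MX \<Longrightarrow> \<bar>f x\<bar> \<le> 1"
  shows "hinge_risk \<pi> f - hinge_opt MX \<pi> = ennreal (\<integral>x. \<bar>g x\<bar> * \<bar>f x - sgn1 (g x)\<bar> \<partial>Q)"
proof -
  have "\<bar>g x\<bar> * \<bar>f x - sgn1 (g x)\<bar> \<le> 1 * 2" if "x \<in> space MX" for x
    using g_bound[of x] b[OF that] by (intro mult_mono) (auto simp: sgn1_def)
  then have "integrable Q (\<lambda>x. \<bar>g x\<bar> * \<bar>f x - sgn1 (g x)\<bar>)"
    by (intro integrable_const_bound[where B = 2] AE_I2) (auto simp: space_Q)
  then have "(\<integral>\<^sup>+ x. ennreal (\<bar>g x\<bar> * \<bar>f x - sgn1 (g x)\<bar>) \<partial>Q) = ennreal (\<integral>x. \<bar>g x\<bar> * \<bar>f x - sgn1 (g x)\<bar> \<partial>Q)"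
    by (intro nn_integral_eq_integral) auto
  then show ?thesis
    using hinge_opt_finite unfolding hinge_opt_eq
    by (subst hinge_risk_bounded) (auto simp: b)
qed

lemma cls_risk_eq:
  assumes f [measurable]: "f \<in> borel_measurable MX" and b: "\<And>x. x \<in> space MX \<Longrightarrow> f x \<in> {-1, 1}"
  shows "cls_risk \<pi> f = (\<integral>x. (1 - g x * f x) / 2 \<partial>Q)"
proof -
  note fst_measurable [measurable] snd_measurable [measurable]
  let ?S = "{z \<in> space (XY MX). snd z \<noteq> f (fst z)}"
  have S [measurable]: "?S \<in> sets (XY MX)" by measurable
  have sp: "space \<pi> = space (XY MX)" using sets_pi by (rule sets_eq_imp_space_eq)
  have "emeasure \<pi> ?S = (\<integral>\<^sup>+ z. indicator ?S z \<partial>\<pi>)" using S sets_pi by simp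
  also have "\<dots> = (\<integral>\<^sup>+ x. ennreal ((1 - g x * f x) / 2) \<partial>Q)"
  proof (subst nn_integral_noise)
    show "(\<integral>\<^sup>+ x. ennreal ((1 + g x) / 2) * indicator ?S (x, 1) + ennreal ((1 - g x) / 2) * indicator ?S (x, -1) \<partial>Q)
      = (\<integral>\<^sup>+ x. ennreal ((1 - g x * f x) / 2) \<partial>Q)"
    proof (rule nn_integral_cong)
      fix x assume "x \<in> space Q"
      then have "x \<in> space MX" "f x = 1 \<or> f x = -1" using b by (auto simp: space_Q)
      then show "ennreal ((1 + g x) / 2) * indicator ?S (x, 1) + ennreal ((1 - g x) / 2) * indicator ?S (x, -1)
        = ennreal ((1 - g x * f x) / 2)"
        by (auto simp: XY_def space_pair_measure)
    qed
  qed measurable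
  finally have e: "emeasure \<pi> ?S = \<dots>" .
  have "0 \<le> (1 - g x * f x) / 2" if "x \<in> space MX" for x
    using b[OF that] g_bound[of x] by auto
  then have "(\<integral>x. (1 - g x * f x) / 2 \<partial>Q) = enn2real (\<integral>\<^sup>+ x. ennreal ((1 - g x * f x) / 2) \<partial>Q)"
    by (intro integral_eq_nn_integral AE_I2) (auto simp: space_Q)
  then show ?thesis by (simp add: cls_risk_def measure_def sp e)
qed

text \<open>For rules with values -1 and 1 the excess hinge risk is twice the excess classification
  risk, so a single integral controls both margin conditions.\<close>

lemma excess_cls:
  assumes f [measurable]: "f \<in> borel_measurable MX" and b: "\<And>x. x \<in> space MX \<Longrightarrow> f x \<in> {-1, 1}"
  shows "2 * (cls_risk \<pi> f - cls_risk \<pi> (\<lambda>x. sgn1 (g x))) = (\<integral>x. \<bar>g x\<bar> * \<bar>f x - sgn1 (g x)\<bar> \<partial>Q)"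
proof -
  have int: "integrable Q (\<lambda>x. (1 - g x * h x) / 2)"
    if [measurable]: "h \<in> borel_measurable MX" and "\<And>x. x \<in> space MX \<Longrightarrow> h x \<in> {-1, 1}" for h :: "'a \<Rightarrow> real"
    using that(2) g_bound
    by (intro integrable_const_bound[where B = 1] AE_I2) (fastforce simp: space_Q abs_le_iff)+
  let ?d = "\<lambda>x. (1 - g x * f x) / 2 - (1 - g x * sgn1 (g x)) / 2"
  have "cls_risk \<pi> f - cls_risk \<pi> (\<lambda>x. sgn1 (g x))
    = (\<integral>x. (1 - g x * f x) / 2 - (1 - g x * sgn1 (g x)) / 2 \<partial>Q)"
    using b sgn1_cases by (subst Bochner_Integration.integral_diff) (auto simp: cls_risk_eq intro!: int)
  also have "2 * \<dots> = (\<integral>x. 2 * ?d x \<partial>Q)"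
    by (rule integral_mult_right_zero[symmetric])
  also have "\<dots> = (\<integral>x. \<bar>g x\<bar> * \<bar>f x - sgn1 (g x)\<bar> \<partial>Q)"
  proof (rule Bochner_Integration.integral_cong[OF refl])
    fix x assume "x \<in> space Q"
    then have "f x = 1 \<or> f x = -1" using b by (auto simp: space_Q)
    then show "2 * ?d x = \<bar>g x\<bar> * \<bar>f x - sgn1 (g x)\<bar>" by (auto simp: sgn1_def field_simps)
  qed
  finally show ?thesis .
qed

text \<open>Both conditions reduce to one inequality between integrals over \<open>Q\<close>;
  passing from hinge to classification risk only multiplies the constant by 2^(1/\<kappa>).\<close>

lemma margin_conditions:
  assumes "0 < c"
    and H: "\<And>f. f \<in> borel_measurable MX \<Longrightarrow> (\<And>x. x \<in> space MX \<Longrightarrow> \<bar>f x\<bar> \<le> 1) \<Longrightarrow>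
      (\<integral>x. \<bar>f x - sgn1 (g x)\<bar> \<partial>Q) \<le> c * (\<integral>x. \<bar>g x\<bar> * \<bar>f x - sgn1 (g x)\<bar> \<partial>Q) powr (1 / \<kappa>)"
  shows "MA MX \<kappa> \<pi>" "MAH MX \<kappa> c \<pi>"
proof -
  have nn: "0 \<le> (\<integral>x. \<bar>g x\<bar> * \<bar>f x - sgn1 (g x)\<bar> \<partial>Q)" for f by simp
  show "MA MX \<kappa> \<pi>"
    unfolding MA_def
  proof (intro exI[of _ "\<lambda>x. (1 + g x) / 2"] conjI regfun_pi exI[of _ "c * 2 powr (1 / \<kappa>)"] ballI impI)
    show "0 < c * 2 powr (1 / \<kappa>)" using \<open>0 < c\<close> by simp
    fix f assume f: "f \<in> borel_measurable MX" "\<forall>x\<in>space MX. f x \<in> {-1, 1::real}"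
    let ?d = "cls_risk \<pi> f - cls_risk \<pi> (\<lambda>x. sgn1 (g x))"
    have d: "2 * ?d = (\<integral>x. \<bar>g x\<bar> * \<bar>f x - sgn1 (g x)\<bar> \<partial>Q)" using f by (intro excess_cls) auto
    have "(\<integral>x. \<bar>f x - sgn1 (g x)\<bar> \<partial>Q) \<le> c * (2 * ?d) powr (1 / \<kappa>)"
      unfolding d using f by (intro H) (auto simp: abs_if)
    also have "(2 * ?d) powr (1 / \<kappa>) = 2 powr (1 / \<kappa>) * ?d powr (1 / \<kappa>)"
      by (rule powr_mult)
    finally show "(\<integral>x. \<bar>f x - bayes (\<lambda>x. (1 + g x) / 2) x\<bar> \<partial>PX MX \<pi>)
        \<le> c * 2 powr (1 / \<kappa>) * (cls_risk \<pi> f - cls_risk \<pi> (bayes (\<lambda>x. (1 + g x) / 2))) powr (1 / \<kappa>)"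
      unfolding PX_pi bayes_eq by (simp add: mult.assoc)
  qed
  show "MAH MX \<kappa> c \<pi>"
    unfolding MAH_def
  proof (intro exI[of _ "\<lambda>x. (1 + g x) / 2"] conjI regfun_pi ballI impI)
    fix f assume f: "f \<in> borel_measurable MX" "\<forall>x\<in>space MX. f x \<in> {-1..1::real}"
    then have b: "\<bar>f x\<bar> \<le> 1" if "x \<in> space MX" for x using that by (auto simp: abs_le_iff)
    show "(\<integral>x. \<bar>f x - bayes (\<lambda>x. (1 + g x) / 2) x\<bar> \<partial>PX MX \<pi>)
        \<le> c * enn2real (hinge_risk \<pi> f - hinge_opt MX \<pi>) powr (1 / \<kappa>)"
      unfolding PX_pi bayes_eq using nn f b by (subst excess_hinge_bounded) (auto intro!: H)
  qed
qed

text \<open>Extends the formula for nonnegative integrands to bounded signed ones: adding 1 makes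
  the integrand nonnegative, and the shift cancels because both measures have total mass 1.\<close>

lemma integral_noise:
  fixes F :: "'a \<times> real \<Rightarrow> real"
  assumes F [measurable]: "F \<in> borel_measurable (XY MX)" and b: "\<And>z. \<bar>F z\<bar> \<le> 1"
  shows "(\<integral>z. F z \<partial>\<pi>) = (\<integral>x. (1 + g x) / 2 * F (x, 1) + (1 - g x) / 2 * F (x, -1) \<partial>Q)"
proof -
  interpret p: prob_space \<pi> by (rule prob_space_pi)
  have [measurable]: "(\<lambda>x. F (x, y)) \<in> borel_measurable MX" if "y \<in> {-1, 1}" for y
    by (rule measurable_compose[OF _ F]) (use that in \<open>simp add: XY_def\<close>)
  let ?G = "\<lambda>x. (1 + g x) / 2 * F (x, 1) + (1 - g x) / 2 * F (x, -1)"
  have F1: "0 \<le> F z + 1" for z using b[of z] by linarith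
  have G: "?G x + 1 = (1 + g x) / 2 * (F (x, 1) + 1) + (1 - g x) / 2 * (F (x, -1) + 1)" for x
    by (simp add: field_simps)
  have "\<bar>?G x\<bar> \<le> (1 + g x) / 2 * 1 + (1 - g x) / 2 * 1" for x
    using weight_nonneg[of x] b
    by (intro order_trans[OF abs_triangle_ineq] add_mono) (auto simp: abs_mult intro!: mult_left_le)
  then have Gb: "\<bar>?G x\<bar> \<le> 1" for x by (simp add: field_simps)
  have intF: "integrable \<pi> F" using b by (intro p.integrable_const_bound[where B = 1]) auto
  have intG: "integrable Q ?G" using Gb by (intro integrable_const_bound[where B = 1]) auto
  have "(\<integral>z. F z \<partial>\<pi>) + 1 = (\<integral>z. F z + 1 \<partial>\<pi>)"
    using intF by (simp add: p.prob_space)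
  also have "\<dots> = enn2real (\<integral>\<^sup>+ z. ennreal (F z + 1) \<partial>\<pi>)"
    using F1 by (intro integral_eq_nn_integral) auto
  also have "(\<integral>\<^sup>+ z. ennreal (F z + 1) \<partial>\<pi>) = (\<integral>\<^sup>+ x. ennreal (?G x + 1) \<partial>Q)"
    unfolding G using weight_nonneg F1
    by (subst nn_integral_noise) (auto intro!: nn_integral_cong simp: ennreal_plus ennreal_mult simp del: times_divide_eq_left)
  also have "enn2real \<dots> = (\<integral>x. ?G x + 1 \<partial>Q)"
  proof (rule integral_eq_nn_integral[symmetric])
    show "AE x in Q. 0 \<le> ?G x + 1" using add_mono[OF Gb order_refl] Gb by (intro AE_I2) (metis abs_le_D2 add.commute diff_ge_0_iff_ge diff_minus_eq_add)
  qed measurable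
  also have "\<dots> = (\<integral>x. ?G x \<partial>Q) + 1" using intG by (simp add: prob_space)
  finally show ?thesis by simp
qed

text \<open>The function \<open>e\<close> acts as a likelihood ratio that changes the regression
  function and keeps the marginal. It serves to express two neighbouring hypotheses relative to a
  common midpoint.\<close>

lemma density_noise:
  assumes e: "e \<in> borel_measurable (XY MX)" and [measurable]: "g' \<in> borel_measurable MX"
    and e0: "\<And>z. 0 \<le> e z"
    and g': "\<And>x y. y \<in> {-1, 1} \<Longrightarrow> (1 + y * g x) * e (x, y) = 1 + y * g' x"
  shows "density \<pi> (\<lambda>z. ennreal (e z)) = noise_dist Q g'"
proof -
  note density_measurable [measurable]
  have e' [measurable]: "e \<in> borel_measurable (Q \<Otimes>\<^sub>M count_space {-1, 1})"
    using e sets_Q by (simp add: XY_def cong: measurable_cong_sets sets_pair_measure_cong)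
  have *: "(case z of (x, y) \<Rightarrow> ennreal ((1 + y * g x) / 2)) * ennreal (e z)
      = (case z of (x, y) \<Rightarrow> ennreal ((1 + y * g' x) / 2))"
    if zs: "z \<in> space (Q \<Otimes>\<^sub>M count_space {-1, 1})" for z
  proof -
    obtain x y where z: "z = (x, y)" "y \<in> {-1, 1}" using zs by (auto simp: space_pair_measure)
    have "0 \<le> (1 + y * g x) / 2" using z(2) weight_nonneg[of x] by auto
    then have "ennreal ((1 + y * g x) / 2) * ennreal (e z) = ennreal ((1 + y * g x) / 2 * e z)"
      using e0 by (intro ennreal_mult[symmetric])
    also have "(1 + y * g x) / 2 * e z = (1 + y * g' x) / 2" using g'[OF z(2), of x] z(1) by simp
    finally show ?thesis using z by simp
  qed
  show ?thesis
    unfolding noise_dist_def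
  proof (subst density_density_eq)
    have [measurable]: "snd \<in> borel_measurable (Q \<Otimes>\<^sub>M count_space {-1, 1})"
      by (rule measurable_compose[OF measurable_snd]) simp
    have "(\<lambda>(x, y). ennreal ((1 + y * g' x) / 2)) \<in> borel_measurable (Q \<Otimes>\<^sub>M count_space {-1, 1})"
      unfolding case_prod_beta by measurable
    then show "density (Q \<Otimes>\<^sub>M count_space {-1, 1}) (\<lambda>z. (case z of (x, y) \<Rightarrow> ennreal ((1 + y * g x) / 2)) * ennreal (e z))
      = density (Q \<Otimes>\<^sub>M count_space {-1, 1}) (\<lambda>(x, y). ennreal ((1 + y * g' x) / 2))"
      by (intro density_cong AE_I2 *) measurable
  qed measurable
qed

end

subsection \<open>Testing two product measures\<close>

text \<open>Both measures agree on measurable boxes, where the integral of the product factorises,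
  and boxes determine a finite product measure.\<close>

lemma PiM_density:
  fixes e :: "'b \<Rightarrow> real"
  assumes "finite I" "prob_space P" "prob_space (density P (\<lambda>z. ennreal (e z)))"
    and [measurable]: "e \<in> borel_measurable P" and e0: "\<And>z. 0 \<le> e z"
  shows "(\<Pi>\<^sub>M i\<in>I. density P (\<lambda>z. ennreal (e z))) = density (\<Pi>\<^sub>M i\<in>I. P) (\<lambda>D. ennreal (\<Prod>i\<in>I. e (D i)))"
proof -
  interpret P: prob_space P by fact
  interpret R: prob_space "density P (\<lambda>z. ennreal (e z))" by fact
  interpret PP: product_sigma_finite "\<lambda>_. P" by standard
  interpret RR: product_sigma_finite "\<lambda>_. density P (\<lambda>z. ennreal (e z))" by standard
  show ?thesis
  proof (rule RR.PiM_eqI[symmetric])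
    show "finite I" by fact
    show "sets (density (Pi\<^sub>M I (\<lambda>_. P)) (\<lambda>D. ennreal (\<Prod>i\<in>I. e (D i)))) = sets (\<Pi>\<^sub>M i\<in>I. density P (\<lambda>z. ennreal (e z)))"
      by (simp cong: sets_PiM_cong)
    fix A assume "\<And>i. i \<in> I \<Longrightarrow> A i \<in> sets (density P (\<lambda>z. ennreal (e z)))"
    then have A [measurable]: "A i \<in> sets P" if "i \<in> I" for i using that by simp
    have S: "Pi\<^sub>E I A \<in> sets (Pi\<^sub>M I (\<lambda>_. P))" using A \<open>finite I\<close> by (intro sets_PiM_I_finite)
    have "emeasure (density (Pi\<^sub>M I (\<lambda>_. P)) (\<lambda>D. ennreal (\<Prod>i\<in>I. e (D i)))) (Pi\<^sub>E I A)
      = (\<integral>\<^sup>+ D. ennreal (\<Prod>i\<in>I. e (D i)) * indicator (Pi\<^sub>E I A) D \<partial>Pi\<^sub>M I (\<lambda>_. P))"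
      using S by (intro emeasure_density) simp_all
    also have "\<dots> = (\<integral>\<^sup>+ D. (\<Prod>i\<in>I. ennreal (e (D i)) * indicator (A i) (D i)) \<partial>Pi\<^sub>M I (\<lambda>_. P))"
    proof (rule nn_integral_cong)
      fix D assume D: "D \<in> space (Pi\<^sub>M I (\<lambda>_. P))"
      have "indicator (Pi\<^sub>E I A) D = (\<Prod>i\<in>I. indicator (A i) (D i) :: ennreal)"
      proof (cases "D \<in> Pi\<^sub>E I A")
        case True then show ?thesis by (auto intro!: prod.neutral[symmetric] simp: PiE_iff)
      next
        case False
        then obtain i where "i \<in> I" "D i \<notin> A i" using D by (auto simp: space_PiM PiE_iff)
        then show ?thesis using False \<open>finite I\<close> by (auto intro!: prod_zero[symmetric] bexI[of _ i])
      qed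
      then show "ennreal (\<Prod>i\<in>I. e (D i)) * indicator (Pi\<^sub>E I A) D = (\<Prod>i\<in>I. ennreal (e (D i)) * indicator (A i) (D i))"
        using e0 by (simp add: prod.distrib prod_ennreal)
    qed
    also have "\<dots> = (\<Prod>i\<in>I. \<integral>\<^sup>+ z. ennreal (e z) * indicator (A i) z \<partial>P)"
      using \<open>finite I\<close> by (intro PP.product_nn_integral_prod) auto
    also have "\<dots> = (\<Prod>i\<in>I. emeasure (density P (\<lambda>z. ennreal (e z))) (A i))"
      by (intro prod.cong emeasure_density[symmetric]) auto
    finally show "emeasure (density (Pi\<^sub>M I (\<lambda>_. P)) (\<lambda>D. ennreal (\<Prod>i\<in>I. e (D i)))) (Pi\<^sub>E I A)
      = (\<Prod>i\<in>I. emeasure (density P (\<lambda>z. ennreal (e z))) (A i))" .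
  qed
qed

text \<open>Meant for integrands \<open>f\<close> that may be negative, such as the polynomial lower
  bound in the testing argument; the comparison passes through the positive part.\<close>

lemma integral_le_nn_integral:
  fixes f :: "'b \<Rightarrow> real"
  assumes "integrable M f" "\<And>x. x \<in> space M \<Longrightarrow> ennreal (f x) \<le> F x"
  shows "ennreal (\<integral>x. f x \<partial>M) \<le> (\<integral>\<^sup>+ x. F x \<partial>M)"
proof -
  have i: "integrable M (\<lambda>x. max 0 (f x))" using assms(1) by simp
  have "ennreal (\<integral>x. f x \<partial>M) \<le> ennreal (\<integral>x. max 0 (f x) \<partial>M)"
    using assms i by (intro ennreal_leI integral_mono) auto
  also have "\<dots> = (\<integral>\<^sup>+ x. ennreal (max 0 (f x)) \<partial>M)"
    using i by (intro nn_integral_eq_integral[symmetric]) auto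
  also have "\<dots> \<le> (\<integral>\<^sup>+ x. F x \<partial>M)"
    using assms(2) by (intro nn_integral_mono) (simp add: max_def)
  finally show ?thesis .
qed

text \<open>With \<^term>\<open>s = a + b\<close> and \<^term>\<open>d = \<bar>a - b\<bar>\<close>, AM-GM gives
  \<^term>\<open>d \<le> (2/3 * s + 3/2 * (d\<^sup>2 / s)) / 2\<close>, where \<^term>\<open>d\<^sup>2 = s\<^sup>2 - 4 * a * b\<close>; moreover
  \<^term>\<open>1 / s \<ge> 1 - s / 4\<close> by the tangent at \<^term>\<open>s = 2\<close>. The resulting lower bound for
  \<^term>\<open>s - d\<close> is a polynomial, so that its expectation over a product measure factorises.\<close>

lemma two_min_ge:
  fixes a b :: real
  assumes "0 \<le> a" "0 \<le> b"
  shows "3 * (a * b) - 3/4 * (a * (a * b) + a * b * b) - (a + b) / 12 \<le> 2 * min a b"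
proof (cases "a + b = 0")
  case True
  then show ?thesis using assms by (simp add: add_nonneg_eq_0_iff)
next
  case False
  define s d where "s = a + b" and "d = \<bar>a - b\<bar>"
  have s: "0 < s" using False assms by (simp add: s_def)
  have d: "2 * min a b = s - d" by (auto simp: s_def d_def)
  have ab: "4 * (a * b) = s\<^sup>2 - d\<^sup>2" unfolding s_def d_def by (simp add: power2_eq_square algebra_simps)
  have "0 \<le> (2 * s - 3 * d)\<^sup>2" by simp
  then have "12 * (s * d) \<le> 4 * s\<^sup>2 + 9 * d\<^sup>2" by (simp add: power2_eq_square algebra_simps)
  then have 1: "12 * s * d \<le> 13 * s\<^sup>2 - 36 * (a * b)" using ab by simp
  have "s * (1 - s / 4) \<le> 1" using zero_le_power2[of "s - 2"] by (simp add: power2_eq_square algebra_simps)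
  then have "a * b * (s * (1 - s / 4)) \<le> a * b * 1" using assms by (intro mult_left_mono) auto
  with 1 have "s * (12 * d) \<le> s * (13 * s - 36 * (a * b * (1 - s / 4)))"
    by (simp add: power2_eq_square algebra_simps)
  then have "12 * d \<le> 13 * s - 36 * (a * b * (1 - s / 4))" using s by simp
  then show ?thesis unfolding d by (simp add: s_def field_simps)
qed

text \<open>Le Cam's two-point argument with likelihood ratios \<open>a\<close> and \<open>b\<close>
  relative to the midpoint measure. No \<open>F\<close> is close to both 1 and -1, so the sum of
  errors is at least the integral of 2 min(a, b). The polynomial minorant of
  \<open>two_min_ge\<close> only involves moments that factorise over the sample.\<close>

lemma two_point_bound:
  fixes e :: "'b \<Rightarrow> real" and F :: "('i \<Rightarrow> 'b) \<Rightarrow> real"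
  assumes "finite I" "prob_space P"
    and [measurable]: "e \<in> borel_measurable P" and e: "\<And>z. \<bar>e z\<bar> \<le> 1"
    and e1: "(\<integral>z. e z \<partial>P) = 0" and e2: "(\<integral>z. (e z)\<^sup>2 \<partial>P) = \<delta>" and e3: "(\<integral>z. (e z)^3 \<partial>P) = 0"
    and \<delta>: "9/16 \<le> (1 - \<delta>) ^ card I"
    and F [measurable]: "F \<in> borel_measurable (\<Pi>\<^sub>M i\<in>I. P)"
  shows "ennreal (2/3) \<le> (\<integral>\<^sup>+ D. ennreal \<bar>F D - 1\<bar> \<partial>(\<Pi>\<^sub>M i\<in>I. density P (\<lambda>z. ennreal (1 + e z))))
      + (\<integral>\<^sup>+ D. ennreal \<bar>F D + 1\<bar> \<partial>(\<Pi>\<^sub>M i\<in>I. density P (\<lambda>z. ennreal (1 - e z))))"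
proof -
  interpret P: prob_space P by fact
  interpret PP: product_sigma_finite "\<lambda>_. P" by standard
  interpret PI: prob_space "\<Pi>\<^sub>M i\<in>I. P" using assms(2) by (intro prob_space_PiM)
  have bnd: "integrable P f" if [measurable]: "f \<in> borel_measurable P" and "\<And>z. \<bar>f z\<bar> \<le> B" for f :: "'b \<Rightarrow> real" and B
    using that(2) by (intro P.integrable_const_bound[where B = B] AE_I2) auto
  have ebound: "\<bar>e z ^ k\<bar> \<le> 1" for z k using e[of z] by (simp add: power_abs power_le_one)
  have ii: "integrable P e" "integrable P (\<lambda>z. (e z)\<^sup>2)" "integrable P (\<lambda>z. (e z)^3)"
    using e ebound by (auto intro!: bnd)
  have nn: "0 \<le> 1 + e z" "0 \<le> 1 - e z" for z using e[of z] by auto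
  have dens: "prob_space (density P (\<lambda>z. ennreal (f z)))"
    if [measurable]: "f \<in> borel_measurable P" and "integrable P f" "\<And>z. 0 \<le> f z" "(\<integral>z. f z \<partial>P) = 1" for f
  proof (rule prob_spaceI)
    have "emeasure (density P (\<lambda>z. ennreal (f z))) (space P) = (\<integral>\<^sup>+ z. ennreal (f z) \<partial>P)"
      by (subst emeasure_density) (auto intro!: nn_integral_cong)
    also have "\<dots> = ennreal (\<integral>z. f z \<partial>P)" using that by (intro nn_integral_eq_integral) auto
    finally show "emeasure (density P (\<lambda>z. ennreal (f z))) (space (density P (\<lambda>z. ennreal (f z)))) = 1"
      using that by simp
  qed
  have ps: "prob_space (density P (\<lambda>z. ennreal (1 + e z)))" "prob_space (density P (\<lambda>z. ennreal (1 - e z)))"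
    using ii nn e1 P.prob_space by (auto intro!: dens)
  let ?\<P> = "\<Pi>\<^sub>M i\<in>I. P"
  define a b where "a D = (\<Prod>i\<in>I. 1 + e (D i))" and "b D = (\<Prod>i\<in>I. 1 - e (D i))" for D
  have a0: "0 \<le> a D" and b0: "0 \<le> b D" for D unfolding a_def b_def using nn by (auto intro!: prod_nonneg)
  have [measurable]: "a \<in> borel_measurable ?\<P>" "b \<in> borel_measurable ?\<P>"
    unfolding a_def b_def by measurable
  have prod_int: "integrable ?\<P> (\<lambda>D. \<Prod>i\<in>I. f (D i))" "(\<integral>D. (\<Prod>i\<in>I. f (D i)) \<partial>?\<P>) = (\<integral>z. f z \<partial>P) ^ card I"
    if "integrable P f" for f :: "'b \<Rightarrow> real"
    using that \<open>finite I\<close> PP.product_integrable_prod[of I "\<lambda>_. f"] PP.product_integral_prod[of I "\<lambda>_. f"] by auto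
  have A: "integrable ?\<P> a" "(\<integral>D. a D \<partial>?\<P>) = 1" "integrable ?\<P> b" "(\<integral>D. b D \<partial>?\<P>) = 1"
    unfolding a_def b_def using prod_int[of "\<lambda>z. 1 + e z"] prod_int[of "\<lambda>z. 1 - e z"] ii e1 P.prob_space by auto
  have AB: "integrable ?\<P> (\<lambda>D. a D * b D)" "(\<integral>D. a D * b D \<partial>?\<P>) = (1 - \<delta>) ^ card I"
  proof -
    have eq: "(\<lambda>D. a D * b D) = (\<lambda>D. \<Prod>i\<in>I. (\<lambda>z. 1 - (e z)\<^sup>2) (D i))"
      unfolding a_def b_def by (simp add: fun_eq_iff power2_eq_square algebra_simps flip: prod.distrib)
    show "integrable ?\<P> (\<lambda>D. a D * b D)" "(\<integral>D. a D * b D \<partial>?\<P>) = (1 - \<delta>) ^ card I"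
      unfolding eq using prod_int[of "\<lambda>z. 1 - (e z)\<^sup>2"] ii e2 P.prob_space by auto
  qed
  \<comment> \<open>Each factor is (1 + e)(1 - e^2) = 1 + e - e^2 - e^3, whose mean is again 1 -
    \<delta> since the first and third moments of \<open>e\<close> vanish.\<close>
  have AAB: "integrable ?\<P> (\<lambda>D. a D * (a D * b D))" "(\<integral>D. a D * (a D * b D) \<partial>?\<P>) = (1 - \<delta>) ^ card I"
  proof -
    have eq: "(\<lambda>D. a D * (a D * b D)) = (\<lambda>D. \<Prod>i\<in>I. (\<lambda>z. 1 + e z - (e z)\<^sup>2 - (e z)^3) (D i))"
      unfolding a_def b_def by (simp add: fun_eq_iff power2_eq_square power3_eq_cube algebra_simps flip: prod.distrib)
    show "integrable ?\<P> (\<lambda>D. a D * (a D * b D))" "(\<integral>D. a D * (a D * b D) \<partial>?\<P>) = (1 - \<delta>) ^ card I"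
      unfolding eq using prod_int[of "\<lambda>z. 1 + e z - (e z)\<^sup>2 - (e z)^3"] ii e1 e2 e3 P.prob_space by auto
  qed
  have ABB: "integrable ?\<P> (\<lambda>D. a D * b D * b D)" "(\<integral>D. a D * b D * b D \<partial>?\<P>) = (1 - \<delta>) ^ card I"
  proof -
    have eq: "(\<lambda>D. a D * b D * b D) = (\<lambda>D. \<Prod>i\<in>I. (\<lambda>z. 1 - e z - (e z)\<^sup>2 + (e z)^3) (D i))"
      unfolding a_def b_def by (simp add: fun_eq_iff power2_eq_square power3_eq_cube algebra_simps flip: prod.distrib)
    show "integrable ?\<P> (\<lambda>D. a D * b D * b D)" "(\<integral>D. a D * b D * b D \<partial>?\<P>) = (1 - \<delta>) ^ card I"
      unfolding eq using prod_int[of "\<lambda>z. 1 - e z - (e z)\<^sup>2 + (e z)^3"] ii e1 e2 e3 P.prob_space by auto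
  qed
  let ?G = "\<lambda>D. 3 * (a D * b D) - 3/4 * (a D * (a D * b D) + a D * b D * b D) - (a D + b D) / 12"
  have intG: "integrable ?\<P> ?G" using A AB AAB ABB by simp
  have "(\<integral>D. ?G D \<partial>?\<P>) = 3/2 * (1 - \<delta>) ^ card I - 1/6"
    using A AB AAB ABB by simp
  \<comment> \<open>Numerically 3/2 * 9/16 - 1/6 = 65/96, slightly more than 2/3.\<close>
  then have "ennreal (2/3) \<le> ennreal (\<integral>D. ?G D \<partial>?\<P>)"
    using \<delta> by (intro ennreal_leI) linarith
  also have "\<dots> \<le> (\<integral>\<^sup>+ D. ennreal (a D) * ennreal \<bar>F D - 1\<bar> + ennreal (b D) * ennreal \<bar>F D + 1\<bar> \<partial>?\<P>)"
  proof (rule integral_le_nn_integral[OF intG])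
    fix D
    have "?G D \<le> 2 * min (a D) (b D)" by (rule two_min_ge[OF a0 b0])
    also have "\<dots> \<le> min (a D) (b D) * (\<bar>F D - 1\<bar> + \<bar>F D + 1\<bar>)"
      using a0[of D] b0[of D] by (subst mult.commute, intro mult_left_mono) auto
    also have "\<dots> \<le> a D * \<bar>F D - 1\<bar> + b D * \<bar>F D + 1\<bar>"
      unfolding distrib_left by (intro add_mono mult_right_mono) auto
    finally show "ennreal (?G D) \<le> ennreal (a D) * ennreal \<bar>F D - 1\<bar> + ennreal (b D) * ennreal \<bar>F D + 1\<bar>"
      using a0[of D] b0[of D] by (simp add: ennreal_leI flip: ennreal_mult ennreal_plus)
  qed
  also have "\<dots> = (\<integral>\<^sup>+ D. ennreal (a D) * ennreal \<bar>F D - 1\<bar> \<partial>?\<P>) + (\<integral>\<^sup>+ D. ennreal (b D) * ennreal \<bar>F D + 1\<bar> \<partial>?\<P>)"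
    by (intro nn_integral_add) auto
  also have "(\<integral>\<^sup>+ D. ennreal (a D) * ennreal \<bar>F D - 1\<bar> \<partial>?\<P>)
    = (\<integral>\<^sup>+ D. ennreal \<bar>F D - 1\<bar> \<partial>(\<Pi>\<^sub>M i\<in>I. density P (\<lambda>z. ennreal (1 + e z))))"
    using nn ps \<open>finite I\<close> by (subst PiM_density) (auto simp: a_def nn_integral_density P.prob_space_axioms)
  also have "(\<integral>\<^sup>+ D. ennreal (b D) * ennreal \<bar>F D + 1\<bar> \<partial>?\<P>)
    = (\<integral>\<^sup>+ D. ennreal \<bar>F D + 1\<bar> \<partial>(\<Pi>\<^sub>M i\<in>I. density P (\<lambda>z. ennreal (1 - e z))))"
    using nn ps \<open>finite I\<close> by (subst PiM_density) (auto simp: b_def nn_integral_density P.prob_space_axioms)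
  finally show ?thesis .
qed

subsection \<open>The hard instances\<close>

locale hard_instance =
  fixes MX :: "'a measure" and X :: "'a set" and x0 :: 'a and w h :: real
  assumes finX: "finite X" and X_sub: "X \<subseteq> space MX" and x0: "x0 \<in> space MX" "x0 \<notin> X"
    and singletons: "\<And>x. x \<in> space MX \<Longrightarrow> {x} \<in> sets MX"
    and w: "0 \<le> w" "real (card X) * w \<le> 1" and h: "0 < h" "h \<le> 1"
begin

text \<open>The image under the identity moves the finitely supported measure from the power set of
  its support to the \<sigma>-algebra of \<open>MX\<close>.\<close>

definition Q :: "'a measure" where
  "Q = distr (point_measure (insert x0 X) (\<lambda>x. ennreal (if x = x0 then 1 - real (card X) * w else w))) MX (\<lambda>x. x)"

lemma sets_Q [measurable_cong]: "sets Q = sets MX"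
  by (simp add: Q_def)

lemma ident_measurable: "(\<lambda>x. x) \<in> measurable (point_measure (insert x0 X) p) MX"
  using X_sub x0 by (auto simp: measurable_def sets_point_measure space_point_measure)

lemma nn_integral_Q:
  assumes f: "f \<in> borel_measurable MX"
  shows "(\<integral>\<^sup>+ x. f x \<partial>Q) = ennreal (1 - real (card X) * w) * f x0 + ennreal w * (\<Sum>x\<in>X. f x)"
proof -
  have "(\<integral>\<^sup>+ x. f x \<partial>Q) = (\<Sum>x\<in>insert x0 X. ennreal (if x = x0 then 1 - real (card X) * w else w) * f x)"
    unfolding Q_def using finX
    by (subst nn_integral_distr[OF ident_measurable])
       (simp_all add: f nn_integral_point_measure_finite)
  also have "\<dots> = ennreal (1 - real (card X) * w) * f x0 + (\<Sum>x\<in>X. ennreal w * f x)"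
    using finX x0 by (auto intro!: sum.cong)
  finally show ?thesis by (simp add: sum_distrib_left)
qed

lemma prob_space_Q: "prob_space Q"
proof (rule prob_spaceI)
  have "emeasure Q (space Q) = (\<integral>\<^sup>+ x. 1 \<partial>Q)" by simp
  also have "\<dots> = ennreal (1 - real (card X) * w) + ennreal w * ennreal (real (card X))"
    by (subst nn_integral_Q) (auto simp: ennreal_of_nat_eq_real_of_nat)
  also have "\<dots> = 1"
    using w by (simp add: mult.commute flip: ennreal_mult ennreal_plus)
  finally show "emeasure Q (space Q) = 1" .
qed

lemma integral_Q:
  fixes f :: "'a \<Rightarrow> real"
  assumes f [measurable]: "f \<in> borel_measurable MX" and f0: "\<And>x. 0 \<le> f x"
  shows "(\<integral>x. f x \<partial>Q) = (1 - real (card X) * w) * f x0 + w * (\<Sum>x\<in>X. f x)"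
proof -
  have "(\<integral>x. f x \<partial>Q) = enn2real (\<integral>\<^sup>+ x. ennreal (f x) \<partial>Q)"
    using f0 by (intro integral_eq_nn_integral) auto
  also have "(\<integral>\<^sup>+ x. ennreal (f x) \<partial>Q) = ennreal ((1 - real (card X) * w) * f x0 + w * (\<Sum>x\<in>X. f x))"
    using f0 w by (subst nn_integral_Q) (auto simp: sum_nonneg ennreal_mult ennreal_plus simp flip: sum_ennreal)
  finally show ?thesis using f0 w by (simp add: sum_nonneg del: ennreal_plus)
qed

text \<open>Subsets \<open>T\<close> of \<open>X\<close> encode sign patterns, with -1 exactly on
  \<open>T\<close>. Off \<open>X\<close>, in particular at \<open>x0\<close>, the value 1 means that
  the label is 1 without noise.\<close>

definition bias :: "'a set \<Rightarrow> 'a \<Rightarrow> real" where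
  "bias T x = (if x \<in> X then if x \<in> T then - h else h else 1)"

definition sign_rule :: "'a set \<Rightarrow> 'a \<Rightarrow> real" where
  "sign_rule T x = (if x \<in> T then -1 else 1)"

lemma subset_sets: "T \<subseteq> X \<Longrightarrow> T \<in> sets MX"
proof (rule sets.countable)
  assume T: "T \<subseteq> X"
  show "countable T" using finite_subset[OF T finX] by (rule countable_finite)
  show "{a} \<in> sets MX" if "a \<in> T" for a using that T X_sub by (intro singletons) auto
qed

lemma sign_rule_measurable [measurable]: "T \<subseteq> X \<Longrightarrow> sign_rule T \<in> borel_measurable MX"
  unfolding sign_rule_def[abs_def] using subset_sets[of T] by measurable

lemma bias_measurable [measurable]: "T \<subseteq> X \<Longrightarrow> bias T \<in> borel_measurable MX"
  unfolding bias_def[abs_def] using subset_sets[of T] subset_sets[of X] by measurable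

lemma sgn1_bias: "T \<subseteq> X \<Longrightarrow> sgn1 (bias T x) = sign_rule T x"
  using h by (auto simp: sgn1_def bias_def sign_rule_def)

lemma abs_bias: "\<bar>bias T x\<bar> = (if x \<in> X then h else 1)"
  using h by (auto simp: bias_def)

lemma noise_bias: "T \<subseteq> X \<Longrightarrow> noise Q MX (bias T)"
  using h unfolding noise_def noise_axioms_def
  by (auto simp: prob_space_Q sets_Q abs_bias bias_measurable)

text \<open>The deviation from the Bayes rule splits into a part over \<open>X\<close> and a part at
  \<open>x0\<close>; the weight |2\<eta> - 1| multiplies the first by \<open>h\<close> and the
  second by 1. This is the form treated in \<open>margin_inequality\<close>.\<close>

lemma margin_bias:
  assumes T: "T \<subseteq> X" and "1 \<le> \<kappa>"
    and "real (card X) * w * (1 - h) \<le> 1/3" "(real (card X) * w) powr (\<kappa> - 1) \<le> 3/2 * h"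
  shows "MA MX \<kappa> (noise_dist Q (bias T))" "MAH MX \<kappa> (margin_const \<kappa>) (noise_dist Q (bias T))"
proof -
  interpret noise Q MX "bias T" by (rule noise_bias[OF T])
  let ?v = "real (card X) * w"
  have "(\<integral>x. \<bar>f x - sgn1 (bias T x)\<bar> \<partial>Q)
      \<le> margin_const \<kappa> * (\<integral>x. \<bar>bias T x\<bar> * \<bar>f x - sgn1 (bias T x)\<bar> \<partial>Q) powr (1 / \<kappa>)"
    if [measurable]: "f \<in> borel_measurable MX" and b: "\<And>x. x \<in> space MX \<Longrightarrow> \<bar>f x\<bar> \<le> 1" for f
  proof -
    define r where "r x = \<bar>f x - sign_rule T x\<bar>" for x
    have r: "0 \<le> r x" "x \<in> space MX \<Longrightarrow> r x \<le> 2" for x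
      using b[of x] by (auto simp: r_def sign_rule_def)
    have [measurable]: "sign_rule T \<in> borel_measurable MX" "bias T \<in> borel_measurable MX"
      using T by (simp_all add: sign_rule_measurable bias_measurable)
    have rm [measurable]: "r \<in> borel_measurable MX" unfolding r_def by measurable
    have "w * (\<Sum>x\<in>X. r x) \<le> w * (real (card X) * 2)"
      using w r X_sub by (intro mult_left_mono sum_bounded_above) auto
    then have "w * (\<Sum>x\<in>X. r x) \<le> 2 * ?v" by (simp add: mult_ac)
    moreover have "(1 - ?v) * r x0 \<le> (1 - ?v) * 2"
      using w r x0 by (intro mult_left_mono) auto
    ultimately have "w * (\<Sum>x\<in>X. r x) + (1 - ?v) * r x0
        \<le> margin_const \<kappa> * (h * (w * (\<Sum>x\<in>X. r x)) + (1 - ?v) * r x0) powr (1 / \<kappa>)"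
      using assms w h r by (intro margin_inequality[where v = ?v]) (auto intro!: mult_nonneg_nonneg sum_nonneg)
    moreover have "(\<integral>x. r x \<partial>Q) = w * (\<Sum>x\<in>X. r x) + (1 - ?v) * r x0"
      using r by (subst integral_Q) auto
    moreover have "(\<integral>x. \<bar>bias T x\<bar> * r x \<partial>Q) = h * (w * (\<Sum>x\<in>X. r x)) + (1 - ?v) * r x0"
    proof (subst integral_Q)
      show "(1 - ?v) * (\<bar>bias T x0\<bar> * r x0) + w * (\<Sum>x\<in>X. \<bar>bias T x\<bar> * r x)
        = h * (w * (\<Sum>x\<in>X. r x)) + (1 - ?v) * r x0"
        using x0 by (simp add: abs_bias sum_distrib_left mult_ac)
    qed (use r in auto)
    ultimately show ?thesis unfolding sgn1_bias[OF T] r_def by simp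
  qed
  from margin_conditions[OF margin_const_pos this]
  show "MA MX \<kappa> (noise_dist Q (bias T))" "MAH MX \<kappa> (margin_const \<kappa>) (noise_dist Q (bias T))" by auto
qed

text \<open>Dropping the nonnegative contribution of \<open>x0\<close> leaves a sum over the noisy
  points, which is the additive structure required for Assouad's argument.\<close>

lemma excess_ge_sum:
  assumes T: "T \<subseteq> X" and f [measurable]: "f \<in> borel_measurable MX"
  shows "(\<Sum>x\<in>X. ennreal (w * h) * ennreal \<bar>clip (f x) - sign_rule T x\<bar>)
    \<le> hinge_risk (noise_dist Q (bias T)) f - hinge_opt MX (noise_dist Q (bias T))"
proof -
  interpret noise Q MX "bias T" by (rule noise_bias[OF T])
  have [measurable]: "sign_rule T \<in> borel_measurable MX" "bias T \<in> borel_measurable MX"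
    using T by (simp_all add: sign_rule_measurable bias_measurable)
  have "(\<Sum>x\<in>X. ennreal (w * h) * ennreal \<bar>clip (f x) - sign_rule T x\<bar>)
    = ennreal w * (\<Sum>x\<in>X. ennreal (\<bar>bias T x\<bar> * \<bar>clip (f x) - sgn1 (bias T x)\<bar>))"
    unfolding sum_distrib_left using w h
    by (intro sum.cong) (auto simp: abs_bias sgn1_bias[OF T] ennreal_mult mult.assoc)
  also have "\<dots> \<le> (\<integral>\<^sup>+ x. ennreal (\<bar>bias T x\<bar> * \<bar>clip (f x) - sgn1 (bias T x)\<bar>) \<partial>Q)"
    by (subst nn_integral_Q) auto
  also have "\<dots> \<le> hinge_risk (noise_dist Q (bias T)) f - hinge_opt MX (noise_dist Q (bias T))"
    by (rule excess_hinge_ge) fact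
  finally show ?thesis .
qed

lemma excess_rule:
  assumes T: "T \<subseteq> X"
  shows "hinge_risk (noise_dist Q (bias T)) (sign_rule T) - hinge_opt MX (noise_dist Q (bias T)) = 0"
proof -
  interpret noise Q MX "bias T" by (rule noise_bias[OF T])
  show ?thesis using T by (subst excess_hinge_bounded) (auto simp: sign_rule_def sgn1_bias)
qed

lemma two_point_bias:
  fixes F :: "('i \<Rightarrow> 'a \<times> real) \<Rightarrow> real"
  assumes x: "x \<in> X" and T: "T \<subseteq> X - {x}" and "finite I"
    and n: "9/16 \<le> (1 - w * h\<^sup>2) ^ card I"
    and F: "F \<in> borel_measurable (\<Pi>\<^sub>M i\<in>I. XY MX)"
  shows "ennreal (2/3) \<le> (\<integral>\<^sup>+ D. ennreal \<bar>F D - sign_rule T x\<bar> \<partial>(\<Pi>\<^sub>M i\<in>I. noise_dist Q (bias T)))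
      + (\<integral>\<^sup>+ D. ennreal \<bar>F D - sign_rule (insert x T) x\<bar> \<partial>(\<Pi>\<^sub>M i\<in>I. noise_dist Q (bias (insert x T))))"
proof -
  \<comment> \<open>Under \<open>g0\<close> the label at \<open>x\<close> is a fair coin. The two
    hypotheses have densities 1 + e and 1 - e relative to it. The value of \<open>e\<close> is -h
    for every label other than 1, so the bound on \<open>e\<close> holds on the whole type.\<close>
  define g0 where "g0 = (bias T)(x := 0)"
  define e where "e z = (if fst z = x then if snd z = 1 then h else - h else 0)" for z :: "'a \<times> real"
  have TX: "T \<subseteq> X" and xT: "x \<notin> T" using T by auto
  have xs [measurable]: "{x} \<in> sets MX" using x by (intro subset_sets) auto
  have [measurable]: "bias T \<in> borel_measurable MX" by (rule bias_measurable[OF TX])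
  have g0_eq: "g0 = (\<lambda>y. if y \<in> {x} then 0 else bias T y)" by (auto simp: g0_def)
  interpret noise Q MX g0
  proof (unfold noise_def noise_axioms_def, intro conjI allI)
    show "g0 \<in> borel_measurable MX" unfolding g0_eq by measurable
    show "\<bar>g0 y\<bar> \<le> 1" for y using h by (simp add: g0_eq abs_bias)
  qed (simp_all add: prob_space_Q sets_Q)
  have em [measurable]: "e \<in> borel_measurable (XY MX)"
  proof -
    note fst_measurable [measurable] snd_measurable [measurable]
    have "e = (\<lambda>z. if fst z \<in> {x} then if snd z = 1 then h else - h else 0)" by (auto simp: e_def)
    also have "\<dots> \<in> borel_measurable (XY MX)" by measurable
    finally show ?thesis .
  qed
  have eb: "\<bar>e z\<bar> \<le> 1" for z using h by (auto simp: e_def)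
  \<comment> \<open>By the symmetry of the coin the moments of odd order vanish, and the second is w
    h^2. Requiring k > 0 excludes 0^0 at points other than \<open>x\<close>.\<close>
  have moment: "(\<integral>z. e z ^ k \<partial>noise_dist Q g0) = (\<integral>y. indicator {x} y * ((h ^ k + (- h) ^ k) / 2) \<partial>Q)"
    if "k > 0" for k
  proof (subst integral_noise)
    show "\<bar>e z ^ k\<bar> \<le> 1" for z using eb[of z] by (simp add: power_abs power_le_one)
    show "(\<integral>y. (1 + g0 y) / 2 * e (y, 1) ^ k + (1 - g0 y) / 2 * e (y, -1) ^ k \<partial>Q)
      = (\<integral>y. indicator {x} y * ((h ^ k + (- h) ^ k) / 2) \<partial>Q)"
      using that by (intro Bochner_Integration.integral_cong) (auto simp: e_def g0_def add_divide_distrib power_0_left)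
  qed measurable
  have m1: "(\<integral>z. e z \<partial>noise_dist Q g0) = 0" using moment[of 1] by simp
  have m3: "(\<integral>z. (e z)^3 \<partial>noise_dist Q g0) = 0" using moment[of 3] by simp
  have m2: "(\<integral>z. (e z)\<^sup>2 \<partial>noise_dist Q g0) = w * h\<^sup>2"
  proof -
    have "(\<integral>z. (e z)\<^sup>2 \<partial>noise_dist Q g0) = (\<integral>y. indicator {x} y * h\<^sup>2 \<partial>Q)" using moment[of 2] by simp
    also have "\<dots> = w * (\<Sum>y\<in>X. indicator {x} y * h\<^sup>2)"
      using x x0 by (subst integral_Q) (auto simp: indicator_def)
    also have "(\<Sum>y\<in>X. indicator {x} y * h\<^sup>2) = h\<^sup>2"
      using x finX by (simp add: indicator_def if_distrib[of "\<lambda>c. c * _"] sum.delta cong: if_cong)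
    finally show ?thesis .
  qed
  have d1: "density (noise_dist Q g0) (\<lambda>z. ennreal (1 + e z)) = noise_dist Q (bias T)"
  proof (rule density_noise)
    show "(\<lambda>z. 1 + e z) \<in> borel_measurable (XY MX)" "bias T \<in> borel_measurable MX" by measurable
    show "0 \<le> 1 + e z" for z using eb[of z] by linarith
  qed (use x xT in \<open>auto simp: e_def g0_def bias_def\<close>)
  have d2: "density (noise_dist Q g0) (\<lambda>z. ennreal (1 - e z)) = noise_dist Q (bias (insert x T))"
  proof (rule density_noise)
    show "(\<lambda>z. 1 - e z) \<in> borel_measurable (XY MX)" by measurable
    show "bias (insert x T) \<in> borel_measurable MX" using x TX by (intro bias_measurable) auto
    show "0 \<le> 1 - e z" for z using eb[of z] by linarith
  qed (use x in \<open>auto simp: e_def g0_def bias_def\<close>)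
  have "ennreal (2/3) \<le> (\<integral>\<^sup>+ D. ennreal \<bar>F D - 1\<bar> \<partial>(\<Pi>\<^sub>M i\<in>I. density (noise_dist Q g0) (\<lambda>z. ennreal (1 + e z))))
      + (\<integral>\<^sup>+ D. ennreal \<bar>F D + 1\<bar> \<partial>(\<Pi>\<^sub>M i\<in>I. density (noise_dist Q g0) (\<lambda>z. ennreal (1 - e z))))"
  proof (rule two_point_bound)
    show "e \<in> borel_measurable (noise_dist Q g0)" by measurable
    show "F \<in> borel_measurable (\<Pi>\<^sub>M i\<in>I. noise_dist Q g0)"
      using F sets_PiM_cong[OF refl sets_pi, of I] by (simp cong: measurable_cong_sets)
  qed (use assms m1 m2 m3 eb prob_space_pi in auto)
  then show ?thesis unfolding d1 d2 using xT by (simp add: sign_rule_def)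
qed

section \<open>Averaging over all sign patterns\<close>

text \<open>Pairs each pattern with its neighbour across \<open>x\<close>, as the two-point test
  requires.\<close>

lemma sum_Pow_split:
  fixes B :: "'a set \<Rightarrow> ennreal"
  assumes x: "x \<in> X"
  shows "(\<Sum>T\<in>Pow X. B T) = (\<Sum>T\<in>Pow (X - {x}). B T + B (insert x T))"
proof -
  have inj: "inj_on (insert x) (Pow (X - {x}))" by (rule inj_onI) blast
  have "Pow X = Pow (X - {x}) \<union> insert x ` Pow (X - {x})"
    using Pow_insert[of x "X - {x}"] x by (simp add: insert_absorb)
  then have "(\<Sum>T\<in>Pow X. B T) = (\<Sum>T\<in>Pow (X - {x}) \<union> insert x ` Pow (X - {x}). B T)"
    by simp
  also have "\<dots> = (\<Sum>T\<in>Pow (X - {x}). B T) + (\<Sum>T\<in>insert x ` Pow (X - {x}). B T)"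
    using finX by (intro sum.union_disjoint) auto
  also have "(\<Sum>T\<in>insert x ` Pow (X - {x}). B T) = (\<Sum>T\<in>Pow (X - {x}). B (insert x T))"
    using inj by (simp add: sum.reindex)
  finally show ?thesis by (simp add: sum.distrib)
qed

lemma assouad:
  fixes fbar :: "('i \<Rightarrow> 'a \<times> real) \<Rightarrow> 'a \<Rightarrow> real"
  assumes "finite I" and n: "9/16 \<le> (1 - w * h\<^sup>2) ^ card I"
    and fbar: "(\<lambda>(x, D). fbar D x) \<in> borel_measurable (MX \<Otimes>\<^sub>M (\<Pi>\<^sub>M i\<in>I. XY MX))"
  shows "\<exists>T\<subseteq>X. ennreal (real (card X) * w * h / 3)
    \<le> (\<integral>\<^sup>+ D. (hinge_risk (noise_dist Q (bias T)) (fbar D) - hinge_opt MX (noise_dist Q (bias T)))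
          \<partial>(\<Pi>\<^sub>M i\<in>I. noise_dist Q (bias T)))"
proof -
  define R where "R T = (\<integral>\<^sup>+ D. (hinge_risk (noise_dist Q (bias T)) (fbar D) - hinge_opt MX (noise_dist Q (bias T)))
          \<partial>(\<Pi>\<^sub>M i\<in>I. noise_dist Q (bias T)))" for T
  define B where "B T x = (\<integral>\<^sup>+ D. ennreal \<bar>clip (fbar D x) - sign_rule T x\<bar> \<partial>(\<Pi>\<^sub>M i\<in>I. noise_dist Q (bias T)))" for T x
  have fx: "(\<lambda>D. fbar D x) \<in> borel_measurable (\<Pi>\<^sub>M i\<in>I. XY MX)" if "x \<in> X" for x
    using measurable_compose[OF measurable_Pair1' fbar, of x] that X_sub by auto
  have fD: "fbar D \<in> borel_measurable MX" if "D \<in> space (\<Pi>\<^sub>M i\<in>I. XY MX)" for D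
    using measurable_compose[OF measurable_Pair2'[OF that] fbar] by simp
  have setsI: "sets (\<Pi>\<^sub>M i\<in>I. noise_dist Q (bias T)) = sets (\<Pi>\<^sub>M i\<in>I. XY MX)" for T
    by (intro sets_PiM_cong refl sets_noise_dist sets_Q)
  have RB: "(\<Sum>x\<in>X. ennreal (w * h) * B T x) \<le> R T" if T: "T \<subseteq> X" for T
  proof -
    have [measurable]: "(\<lambda>D. fbar D x) \<in> borel_measurable (\<Pi>\<^sub>M i\<in>I. noise_dist Q (bias T))" if "x \<in> X" for x
      using fx[OF that] setsI[of T] by (simp cong: measurable_cong_sets)
    have "(\<Sum>x\<in>X. ennreal (w * h) * B T x)
      = (\<integral>\<^sup>+ D. (\<Sum>x\<in>X. ennreal (w * h) * ennreal \<bar>clip (fbar D x) - sign_rule T x\<bar>) \<partial>(\<Pi>\<^sub>M i\<in>I. noise_dist Q (bias T)))"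
      unfolding B_def by (subst nn_integral_sum) (auto simp: nn_integral_cmult)
    also have "\<dots> \<le> R T"
      unfolding R_def
      using sets_eq_imp_space_eq[OF setsI[of T]] by (intro nn_integral_mono excess_ge_sum T fD) simp
    finally show ?thesis .
  qed
  let ?P = "Pow X"
  have finP: "finite ?P" and neP: "?P \<noteq> {}" using finX by auto
  \<comment> \<open>The pattern of largest risk does at least as badly as the average over all
    patterns, and the average is what the two-point tests bound.\<close>
  have "Max (R ` ?P) \<in> R ` ?P" using finP neP by (intro Max_in) auto
  then obtain T where T: "T \<subseteq> X" and "Max (R ` ?P) = R T" by auto
  then have max: "R S \<le> R T" if "S \<subseteq> X" for S
    using finP that Max_ge[of "R ` ?P" "R S"] by auto
  \<comment> \<open>Each pair of neighbours across \<open>x\<close> has total error at least 2/3,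
    that is, 1/3 per pattern.\<close>
  have half: "of_nat (card ?P) * ennreal (1/3) \<le> (\<Sum>T\<in>?P. B T x)" if x: "x \<in> X" for x
  proof -
    have "card ?P = 2 * card (Pow (X - {x}))"
      using card.remove[OF finX x] finX by (simp add: card_Pow)
    then have "of_nat (card ?P) * ennreal (1/3) = of_nat (card (Pow (X - {x}))) * (2 * ennreal (1/3))"
      by (simp add: mult_ac)
    also have "2 * ennreal (1/3) = ennreal (2/3)" by (simp flip: ennreal_numeral ennreal_mult)
    also have "of_nat (card (Pow (X - {x}))) * ennreal (2/3) \<le> (\<Sum>T\<in>Pow (X - {x}). B T x + B (insert x T) x)"
    proof (rule sum_bounded_below)
      fix T assume "T \<in> Pow (X - {x})"
      then have T: "T \<subseteq> X - {x}" by simp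
      have "(\<lambda>D. clip (fbar D x)) \<in> borel_measurable (\<Pi>\<^sub>M i\<in>I. XY MX)"
        using fx[OF x] by measurable
      from two_point_bias[OF x T assms(1) n this]
      show "ennreal (2/3) \<le> B T x + B (insert x T) x"
        unfolding B_def .
    qed
    also have "\<dots> = (\<Sum>T\<in>?P. B T x)" by (rule sum_Pow_split[OF x, symmetric])
    finally show ?thesis .
  qed
  have "of_nat (card ?P) * ennreal (real (card X) * w * h / 3)
      = (\<Sum>x\<in>X. ennreal (w * h) * (of_nat (card ?P) * ennreal (1/3)))"
  proof -
    have "ennreal (real (card X) * w * h / 3) = of_nat (card X) * (ennreal (w * h) * ennreal (1/3))"
      using w h by (simp add: ennreal_of_nat_eq_real_of_nat flip: ennreal_mult)
    then show ?thesis by (simp add: mult_ac)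
  qed
  also have "\<dots> \<le> (\<Sum>x\<in>X. ennreal (w * h) * (\<Sum>T\<in>?P. B T x))"
    using half by (intro sum_mono mult_left_mono) auto
  also have "\<dots> = (\<Sum>T\<in>?P. \<Sum>x\<in>X. ennreal (w * h) * B T x)"
    unfolding sum_distrib_left by (rule sum.swap)
  also have "\<dots> \<le> (\<Sum>T\<in>?P. R T)" using RB by (intro sum_mono) auto
  also have "\<dots> \<le> of_nat (card ?P) * R T" using max by (intro sum_bounded_above) auto
  finally have "ennreal (real (card X) * w * h / 3) \<le> R T"
    using finP neP by (subst (asm) ennreal_mult_le_mult_iff) auto
  then show ?thesis using T unfolding R_def by blast
qed

lemma lower_bound:
  assumes "1 \<le> \<kappa>" "real (card X) * w * (1 - h) \<le> 1/3" "(real (card X) * w) powr (\<kappa> - 1) \<le> 3/2 * h"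
    and n: "9/16 \<le> (1 - w * h\<^sup>2) ^ n" and M: "2 ^ card X \<le> M"
    and rate: "lb_const \<kappa> (margin_const \<kappa>) * (ln (real M) / real n) powr (\<kappa> / (2 * \<kappa> - 1)) \<le> real (card X) * w * h / 3"
  shows "\<exists>F :: nat \<Rightarrow> 'a \<Rightarrow> real.
       (\<forall>i<M. F i \<in> borel_measurable MX \<and> (\<forall>x\<in>space MX. F i x \<in> {-1, 1})) \<and>
       (\<forall>fbar :: (nat \<Rightarrow> 'a \<times> real) \<Rightarrow> 'a \<Rightarrow> real.
          (\<lambda>(x, D). fbar D x) \<in> borel_measurable (MX \<Otimes>\<^sub>M (\<Pi>\<^sub>M i\<in>{..<n}. XY MX)) \<longrightarrow>
          (\<exists>\<pi>. prob_space \<pi> \<and> sets \<pi> = sets (XY MX) \<and> MA MX \<kappa> \<pi> \<and> MAH MX \<kappa> (margin_const \<kappa>) \<pi> \<and>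
             (let m = enn2real (INF f \<in> conv_rules M F. hinge_risk \<pi> f - hinge_opt MX \<pi>)
              in (\<integral>\<^sup>+ D. (hinge_risk \<pi> (fbar D) - hinge_opt MX \<pi>) \<partial>(\<Pi>\<^sub>M i\<in>{..<n}. \<pi>))
                 \<ge> ennreal (m + lb_const \<kappa> (margin_const \<kappa>) *
                      (sqrt (m powr (1 / \<kappa>) * ln (real M) / real n)
                       + (ln (real M) / real n) powr (\<kappa> / (2 * \<kappa> - 1)))))))"
proof -
  obtain p where p: "bij_betw p {0..<card (Pow X)} (Pow X)"
    using ex_bij_betw_nat_finite[of "Pow X"] finX by auto
  \<comment> \<open>The first 2^N indices run through all sign patterns. Intersecting with
    \<open>X\<close> turns \<open>p i\<close> into a subset of \<open>X\<close> for the further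
    indices too, so every rule is measurable.\<close>
  define F where "F i = sign_rule (p i \<inter> X)" for i
  have "\<exists>\<pi>. prob_space \<pi> \<and> sets \<pi> = sets (XY MX) \<and> MA MX \<kappa> \<pi> \<and> MAH MX \<kappa> (margin_const \<kappa>) \<pi> \<and>
             (let m = enn2real (INF f \<in> conv_rules M F. hinge_risk \<pi> f - hinge_opt MX \<pi>)
              in (\<integral>\<^sup>+ D. (hinge_risk \<pi> (fbar D) - hinge_opt MX \<pi>) \<partial>(\<Pi>\<^sub>M i\<in>{..<n}. \<pi>))
                 \<ge> ennreal (m + lb_const \<kappa> (margin_const \<kappa>) *
                      (sqrt (m powr (1 / \<kappa>) * ln (real M) / real n)
                       + (ln (real M) / real n) powr (\<kappa> / (2 * \<kappa> - 1)))))"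
    if fbar: "(\<lambda>(x, D). fbar D x) \<in> borel_measurable (MX \<Otimes>\<^sub>M (\<Pi>\<^sub>M i\<in>{..<n}. XY MX))"
    for fbar :: "(nat \<Rightarrow> 'a \<times> real) \<Rightarrow> 'a \<Rightarrow> real"
  proof -
    obtain T where T: "T \<subseteq> X" and R: "ennreal (real (card X) * w * h / 3)
      \<le> (\<integral>\<^sup>+ D. (hinge_risk (noise_dist Q (bias T)) (fbar D) - hinge_opt MX (noise_dist Q (bias T)))
          \<partial>(\<Pi>\<^sub>M i\<in>{..<n}. noise_dist Q (bias T)))"
      using assouad[OF _ _ fbar] n by auto
    interpret noise Q MX "bias T" by (rule noise_bias[OF T])
    have "T \<in> p ` {0..<card (Pow X)}" using bij_betw_imp_surj_on[OF p] T by blast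
    then obtain i where i: "i < card (Pow X)" "p i = T" by auto
    have iM: "i < M" using i M finX by (simp add: card_Pow)
    have Fi: "F i = sign_rule T" using i T by (simp add: F_def Int_absorb2)
    \<comment> \<open>Unit weight on the index of the Bayes rule exhibits it as a member of the
      convex hull. The oracle excess is therefore 0, and the square root term vanishes with
      it.\<close>
    have "sign_rule T = (\<lambda>x. \<Sum>j<M. (if j = i then 1 else 0) * F j x)"
      using iM Fi by (simp add: fun_eq_iff if_distrib[of "\<lambda>c. c * _"] cong: if_cong)
    then have "sign_rule T \<in> conv_rules M F"
      unfolding conv_rules_def using iM by (auto intro!: exI[of _ "\<lambda>j. if j = i then 1 else 0"])
    then have "(INF f \<in> conv_rules M F. hinge_risk \<pi> f - hinge_opt MX \<pi>) \<le> hinge_risk \<pi> (sign_rule T) - hinge_opt MX \<pi>"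
      by (rule INF_lower)
    also have "\<dots> = 0" by (rule excess_rule[OF T])
    finally have "(INF f \<in> conv_rules M F. hinge_risk \<pi> f - hinge_opt MX \<pi>) \<le> 0" .
    then have m: "(INF f \<in> conv_rules M F. hinge_risk \<pi> f - hinge_opt MX \<pi>) = 0" by simp
    show ?thesis
    proof (intro exI[of _ \<pi>] conjI prob_space_pi sets_pi margin_bias[OF T assms(1-3)], unfold m Let_def)
      show "ennreal (enn2real 0 + lb_const \<kappa> (margin_const \<kappa>) *
          (sqrt (enn2real 0 powr (1 / \<kappa>) * ln (real M) / real n) + (ln (real M) / real n) powr (\<kappa> / (2 * \<kappa> - 1))))
        \<le> (\<integral>\<^sup>+ D. (hinge_risk \<pi> (fbar D) - hinge_opt MX \<pi>) \<partial>(\<Pi>\<^sub>M i\<in>{..<n}. \<pi>))"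
        using order_trans[OF ennreal_leI[OF rate] R] by simp
    qed
  qed
  moreover have "\<forall>i<M. F i \<in> borel_measurable MX \<and> (\<forall>x\<in>space MX. F i x \<in> {-1, 1})"
    by (auto simp: F_def sign_rule_def intro!: sign_rule_measurable)
  ultimately show ?thesis by (intro exI[of _ F]) auto
qed

end

section \<open>Number of noisy points and final choice of parameters\<close>

lemma floor_log2_ge:
  fixes M N :: nat
  assumes "2 \<le> M" "2 ^ N \<le> M" "M < 2 ^ (N + 1)"
  shows "1 \<le> N" "real N \<le> log 2 (real M)" "3/5 * log 2 (real M) \<le> real N"
proof -
  show N: "1 \<le> N" using assms by (cases N) auto
  have "2 ^ N \<le> real M" using assms(2) by (metis of_nat_le_iff of_nat_numeral of_nat_power)
  then have "2 powr real N \<le> real M" by (simp add: powr_realpow)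
  then show "real N \<le> log 2 (real M)" using assms by (simp add: le_log_iff)
  \<comment> \<open>The factor 3/5 amounts to M^3 \<le> 2^(5N). For N \<ge> 2 this follows from 3(N
    + 1) \<le> 5N; for N = 1 that inequality fails, but M \<le> 3 and 27 \<le> 32.\<close>
  have "real (M ^ 3) \<le> real (2 ^ (5 * N))"
  proof (cases "N = 1")
    case True
    then have "M = 2 \<or> M = 3" using assms by auto
    then show ?thesis using True by auto
  next
    case False
    have "M ^ 3 \<le> (2 ^ (N + 1)) ^ 3" using assms by (intro power_mono) auto
    also have "\<dots> = 2 ^ (3 * (N + 1))" by (simp only: mult.commute flip: power_mult)
    also have "\<dots> \<le> 2 ^ (5 * N)" using False N by (intro power_increasing) auto
    finally show ?thesis by (simp only: of_nat_le_iff)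
  qed
  then have "log 2 (real M ^ 3) \<le> log 2 (2 ^ (5 * N))" using assms by (subst log_le_cancel_iff) auto
  then show "3/5 * log 2 (real M) \<le> real N" using assms by (simp add: log_nat_power)
qed

theorem theorem2:
  fixes MX :: "'a measure" and \<kappa> :: real
  assumes "\<kappa> \<ge> 1"
    and "infinite (space MX)"
    and "\<forall>x\<in>space MX. {x} \<in> sets MX"
  shows "\<exists>c>0. \<forall>M n :: nat. 1 \<le> M \<longrightarrow> 1 \<le> n \<longrightarrow> 2 * log 2 (real M) \<le> real n \<longrightarrow>
    (\<exists>F :: nat \<Rightarrow> 'a \<Rightarrow> real.
       (\<forall>i<M. F i \<in> borel_measurable MX \<and> (\<forall>x\<in>space MX. F i x \<in> {-1, 1})) \<and>
       (\<forall>fbar :: (nat \<Rightarrow> 'a \<times> real) \<Rightarrow> 'a \<Rightarrow> real.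
          (\<lambda>(x, D). fbar D x) \<in> borel_measurable (MX \<Otimes>\<^sub>M (\<Pi>\<^sub>M i\<in>{..<n}. XY MX)) \<longrightarrow>
          (\<exists>\<pi>. prob_space \<pi> \<and> sets \<pi> = sets (XY MX) \<and> MA MX \<kappa> \<pi> \<and> MAH MX \<kappa> c \<pi> \<and>
             (let m = enn2real (INF f \<in> conv_rules M F. hinge_risk \<pi> f - hinge_opt MX \<pi>)
              in (\<integral>\<^sup>+ D. (hinge_risk \<pi> (fbar D) - hinge_opt MX \<pi>) \<partial>(\<Pi>\<^sub>M i\<in>{..<n}. \<pi>))
                 \<ge> ennreal (m + lb_const \<kappa> c *
                      (sqrt (m powr (1 / \<kappa>) * ln (real M) / real n)
                       + (ln (real M) / real n) powr (\<kappa> / (2 * \<kappa> - 1))))))))"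
proof (intro exI[of _ "margin_const \<kappa>"] conjI margin_const_pos allI impI)
  fix M n :: nat
  assume M: "1 \<le> M" and n: "1 \<le> n" and Mn: "2 * log 2 (real M) \<le> real n"
  obtain N where N: "2 ^ N \<le> M" "M < 2 ^ (N + 1)"
    using ex_power_ivl1[of 2 M] M by auto
  \<comment> \<open>One point more than the \<open>N\<close> noisy ones, to serve as
    \<open>x0\<close>.\<close>
  obtain Y where Y: "Y \<subseteq> space MX" "finite Y" "card Y = Suc N"
    using infinite_arbitrarily_large[OF assms(2)] by blast
  then obtain x0 X where X: "Y = insert x0 X" "x0 \<notin> X" "card X = N"
    by (metis card_Suc_eq)
  have fX: "finite X" "X \<subseteq> space MX" "x0 \<in> space MX" using X Y by auto
  have "\<exists>w h. hard_instance MX X x0 w h \<and> real N * w * (1 - h) \<le> 1/3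
    \<and> (real N * w) powr (\<kappa> - 1) \<le> 3/2 * h \<and> 9/16 \<le> (1 - w * h\<^sup>2) ^ n
    \<and> lb_const \<kappa> (margin_const \<kappa>) * (ln (real M) / real n) powr (\<kappa> / (2 * \<kappa> - 1)) \<le> real N * w * h / 3"
  proof (cases "M = 1")
    case True
    \<comment> \<open>A single rule has ln M = 0, so the required rate is 0 and the instance without
      noisy points suffices.\<close>
    then have "N = 0" using less_le_trans[OF less_exp N(1)] by simp
    then show ?thesis using True fX X assms(3)
      by (intro exI[of _ 0] exI[of _ 1]) (auto simp: hard_instance_def)
  next
    case False
    then have "2 \<le> M" using M by simp
    note fl = floor_log2_ge[OF this N]
    define u where "u = real N / real n"
    define \<theta> where "\<theta> = (\<kappa> - 1) / (2 * \<kappa> - 1)"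
    define v where "v = (1/3) powr (2 * \<theta>) * u powr (1 - 2 * \<theta>)"
    define h where "h = sqrt (u / (2 * v))"
    define L where "L = log 2 (real M) / real n"
    have n2: "2 \<le> n" using fl Mn by linarith
    \<comment> \<open>The assumption 2 log2 M \<le> n enters here, through N \<le> log2 M.\<close>
    have u: "0 < u" "u \<le> 1/2" using fl n Mn by (auto simp: u_def field_simps)
    note par = rate_parameters[OF assms(1) u \<theta>_def v_def h_def]
    have L: "0 < L" "3/5 * L \<le> u"
      using fl n \<open>2 \<le> M\<close> by (auto simp: L_def u_def field_simps)
    have lnM: "ln (real M) / real n = ln 2 * L" by (simp add: L_def log_def)
    have wh: "v / real N * h\<^sup>2 = 1 / (2 * real n)"
    proof -
      have "v / real N * h\<^sup>2 = (v * h\<^sup>2) / real N" by simp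
      also have "\<dots> = 1 / (2 * real n)" unfolding par(7) using fl by (simp add: u_def)
      finally show ?thesis .
    qed
    \<comment> \<open>Weighted AM-GM for 3/4 and 1 with weights 2/n and 1 - 2/n bounds (3/4)^(2/n)
      by 1 - 1/(2n); the n-th power of the left side is 9/16.\<close>
    have "9/16 \<le> (1 - 1 / (2 * real n)) ^ n"
    proof -
      have "(3/4) powr (2 / real n) * 1 powr (1 - 2 / real n) \<le> 2 / real n * (3/4) + (1 - 2 / real n) * 1"
        using n2 by (intro Youngs_inequality_0) auto
      then have "(3/4) powr (2 / real n) \<le> 1 - 1 / (2 * real n)" by (simp add: field_simps)
      then have "((3/4) powr (2 / real n)) ^ n \<le> (1 - 1 / (2 * real n)) ^ n" by (intro power_mono) auto
      moreover have "((3/4) powr (2 / real n)) ^ n = (3/4::real) powr 2"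
        using n by (subst powr_realpow[symmetric]) (simp_all add: powr_powr del: powr_realpow)
      ultimately show ?thesis by (simp add: power2_eq_square)
    qed
    moreover have "hard_instance MX X x0 (v / real N) h"
      using fX X(2,3) assms(3) par(1-4) fl(1) by (simp add: hard_instance_def)
    moreover have "lb_const \<kappa> (margin_const \<kappa>) * (ln (real M) / real n) powr (\<kappa> / (2 * \<kappa> - 1)) \<le> v * h / 3"
      using lb_const_le[OF assms(1) L \<theta>_def] par(8) by (simp add: lnM mult.commute)
    ultimately show ?thesis
      using par(5,6) fl(1) wh by (intro exI[of _ "v / real N"] exI[of _ h]) simp
  qed
  then obtain w h where inst: "hard_instance MX X x0 w h" and
    wh: "real N * w * (1 - h) \<le> 1/3" "(real N * w) powr (\<kappa> - 1) \<le> 3/2 * h" "9/16 \<le> (1 - w * h\<^sup>2) ^ n"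
    "lb_const \<kappa> (margin_const \<kappa>) * (ln (real M) / real n) powr (\<kappa> / (2 * \<kappa> - 1)) \<le> real N * w * h / 3"
    by blast
  show "\<exists>F :: nat \<Rightarrow> 'a \<Rightarrow> real.
       (\<forall>i<M. F i \<in> borel_measurable MX \<and> (\<forall>x\<in>space MX. F i x \<in> {-1, 1})) \<and>
       (\<forall>fbar :: (nat \<Rightarrow> 'a \<times> real) \<Rightarrow> 'a \<Rightarrow> real.
          (\<lambda>(x, D). fbar D x) \<in> borel_measurable (MX \<Otimes>\<^sub>M (\<Pi>\<^sub>M i\<in>{..<n}. XY MX)) \<longrightarrow>
          (\<exists>\<pi>. prob_space \<pi> \<and> sets \<pi> = sets (XY MX) \<and> MA MX \<kappa> \<pi> \<and> MAH MX \<kappa> (margin_const \<kappa>) \<pi> \<and>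
             (let m = enn2real (INF f \<in> conv_rules M F. hinge_risk \<pi> f - hinge_opt MX \<pi>)
              in (\<integral>\<^sup>+ D. (hinge_risk \<pi> (fbar D) - hinge_opt MX \<pi>) \<partial>(\<Pi>\<^sub>M i\<in>{..<n}. \<pi>))
                 \<ge> ennreal (m + lb_const \<kappa> (margin_const \<kappa>) *
                      (sqrt (m powr (1 / \<kappa>) * ln (real M) / real n)
                       + (ln (real M) / real n) powr (\<kappa> / (2 * \<kappa> - 1)))))))"
    using hard_instance.lower_bound[OF inst assms(1), of n M] wh N X by simp
qed

end
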